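(* Let $f$ be a transcendental entire function of order $\sigma(f)=\sigma<1$, and let $0<\varepsilon<\min\{\tfrac18,\,1-\sigma\}$. Then for each positive integer $k$, there exists a set $E\subset(1,\infty)$ of finite logarithmic measure such that for all $r\notin E\cup[0,1]$ and all $z$ with $|z|=r$ satisfying $$|f(z)|>M(r,f)\,\nu(r,f)^{-\frac18+\varepsilon},$$ we have $$\frac{\Delta^k f(z)}{f(z)}=\Big(\frac{\nu(r,f)}{z}\Big)^k\big(1+\mathcal{R}_k(z)\big),$$ where $\mathcal{R}_k(z)=O\big(\nu(r,f)^{-\kappa+\varepsilon}\big)$ (as $r\to\infty$) and $\kappa=\min\{\tfrac18,\,1-\sigma\}$.
   Context: Write $f(z)=\sum_{n\ge0}a_nz^n$. $M(r,f)=\max_{|z|=r}|f(z)|$ is the maximum modulus, $\mu(r,f)=\max_{n\ge0}|a_n|r^n$ is the maximal term, and the central index $\nu(r,f)$ is the greatest exponent $m$ such that $|a_m|r^m=\mu(r,f)$. The order is $\sigma(f)=\limsup_{r\to\infty}\frac{\log\log M(r,f)}{\log r}$. The difference operator is $\Delta f(z)=f(z+1)-f(z)$, with $\Delta^k f=\Delta(\Delta^{k-1}f)$ for $k\ge 2$ and $\Delta^1=\Delta$. A set $E\subset\mathbb{R}$ has finite logarithmic measure if $\int_{E\cap(1,\infty)}\frac{dr}{r}<\infty$. The implied constant in $O(\cdot)$ does not depend on $z$. *)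

theory Defs
  imports "HOL-Complex_Analysis.Complex_Analysis" "HOL-Library.Landau_Symbols"
begin

definition transcendental_entire :: "(complex \<Rightarrow> complex) \<Rightarrow> bool" where
  "transcendental_entire f \<longleftrightarrow>
     f holomorphic_on UNIV \<and> \<not> (\<exists>p :: complex poly. f = poly p)"

(* For entire f and r \<ge> 0 the suprema in max_modulus and max_term are attained, so they are
   maxima. *)

definition max_modulus :: "real \<Rightarrow> (complex \<Rightarrow> complex) \<Rightarrow> real" where
  "max_modulus r f = (SUP z\<in>sphere 0 r. norm (f z))"

definition max_term :: "real \<Rightarrow> (complex \<Rightarrow> complex) \<Rightarrow> real" where
  "max_term r f = (SUP n. norm (fps_nth (fps_expansion f 0) n) * r ^ n)"

(* For r > 0 and f not identically zero, only finitely many m attain the maximal term, so the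
   greatest one exists. *)
definition central_index :: "real \<Rightarrow> (complex \<Rightarrow> complex) \<Rightarrow> nat" where
  "central_index r f =
     (GREATEST m. norm (fps_nth (fps_expansion f 0) m) * r ^ m = max_term r f)"

definition growth_order :: "(complex \<Rightarrow> complex) \<Rightarrow> ereal" where
  "growth_order f = Limsup at_top (\<lambda>r. ereal (ln (ln (max_modulus r f)) / ln r))"

definition forward_diff :: "(complex \<Rightarrow> complex) \<Rightarrow> complex \<Rightarrow> complex" where
  "forward_diff f = (\<lambda>z. f (z + 1) - f z)"

definition finite_log_measure :: "real set \<Rightarrow> bool" where
  "finite_log_measure E \<longleftrightarrow>
     E \<in> sets lebesgue \<and> (\<integral>\<^sup>+ r \<in> E \<inter> {1<..}. ennreal (1 / r) \<partial>lebesgue) < \<infinity>"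

end

theory Submission
  imports Defs "HOL-Real_Asymp.Real_Asymp"
begin

text \<open>
  Let \<open>r = \<bar>z\<bar>\<close> and \<open>N = \<nu>(r)\<close>. Near \<open>z\<close> the function \<open>f(z + w)\<close> resembles
  \<open>f(z) exp(N w / z)\<close>. The \<open>k\<close>-th derivative of the latter at \<open>w = 0\<close> is \<open>f(z) (N / z)^k\<close>, and it
  changes only by a factor \<open>1 + O(N / r)\<close> on the disc of radius \<open>k\<close>, which contains all the points
  that \<open>\<Delta>^k\<close> looks at. An order below \<open>s < 1\<close> gives \<open>N = O(r^s)\<close>, hence
  \<open>N / r = O(N^(s - 1))\<close>; this is the second term in the minimum \<open>\<kappa>\<close>, with \<open>s = \<sigma> + \<epsilon>\<close>
  (\<open>central_index_growth\<close>).
  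
  The resemblance comes from Cauchy's estimates (\<open>forward_diff_local_comparison\<close>). If
  \<open>g(w) = f(z + w) exp(- N w / z)\<close> is \<open>O(M(r))\<close> for \<open>\<bar>w\<bar> \<le> r / (4 L)\<close>, then
  \<open>f(z + w) - f(z) exp(N w / z)\<close> is \<open>O(M(r) L / N)\<close> for \<open>\<bar>w\<bar> \<le> r / N\<close>, and the \<open>k\<close>-th derivative of
  this difference is \<open>O((N / r)^k M(r) L / N)\<close> for \<open>\<bar>w\<bar> \<le> k\<close>. Relative to \<open>f(z) (N / z)^k\<close> this is
  \<open>(L / N) M(r) / \<bar>f(z)\<bar>\<close>. With \<open>L\<close> about \<open>N^(3/4)\<close> and \<open>\<bar>f(z)\<bar> > M(r) N^(- 1/8 + \<epsilon>)\<close> it is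
  \<open>O(N^(- 1/8 - \<epsilon>))\<close>. Treating the whole difference \<open>f(z + w) - f(z) exp(N w / z)\<close> at once avoids
  expanding \<open>\<Delta>^k f\<close> into derivatives of all orders and estimating each of them.
  
  What remains is \<open>\<bar>f(u)\<bar> \<le> C M(r) (\<bar>u\<bar> / r)^N\<close> for \<open>\<bar>\<bar>u\<bar> / r - 1\<bar> \<le> 1 / (4 L)\<close>. Here the exceptional
  radii enter: they are those close to a point \<open>X\<^sub>j\<close> where \<open>\<nu>\<close> first reaches a cube \<open>j^3\<close>, within a
  factor \<open>(1 + 1 / j^2)^2\<close>; the logarithmic lengths are summable (\<open>monotone_slow_growth\<close>). For any other
  radius \<open>\<nu>\<close> stays between consecutive cubes \<open>i^3\<close> and \<open>(i + 1)^3\<close> while \<open>r\<close> is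
  multiplied or divided by \<open>p^2\<close>, where \<open>p = 1 + 1 / (i + 1)^2\<close>. Hence the terms \<open>\<bar>a\<^sub>n\<bar> r^n\<close> decay like
  \<open>p^(- 2 \<bar>n - N\<bar>)\<close> (\<open>term_decay\<close>), and summing them gives
  \<open>\<bar>f(u)\<bar> \<le> B M(r) (\<bar>u\<bar> / r)^N\<close> for \<open>1 / p \<le> \<bar>u\<bar> / r \<le> p\<close>, with \<open>B\<close> of size \<open>i^2\<close>, about \<open>N^(2/3)\<close>
  (\<open>norm_le_max_term\<close>).
  
  The factor \<open>B\<close> is too large, but it is not there on the circle \<open>\<bar>u\<bar> = r\<close> itself. The maximum principle for
  \<open>f(u) / u^(N + L)\<close> and \<open>f(u) / u^(N - L)\<close> on the annuli outside and inside that circle replaces \<open>B\<close> by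
  \<open>(\<bar>u\<bar> / r)^L\<close> or its inverse, as soon as \<open>p^L \<ge> B\<close> (\<open>norm_le_max_modulus_interpolated\<close>). That
  factor is bounded for \<open>\<bar>\<bar>u\<bar> / r - 1\<bar> \<le> 1 / (4 L)\<close>, and \<open>L = N^(3/4)\<close> is large enough because
  \<open>p^L \<ge> exp(L / (2 (i + 1)^2))\<close> and \<open>N^(3/4)\<close> exceeds \<open>i^2\<close> by a power of \<open>i\<close>.
\<close>

section \<open>Differences and derivatives\<close>

text \<open>
  By the mean value theorem on segments of length one: \<open>\<Delta>\<close> of the \<open>(k - 1)\<close>-st derivative of
  \<open>F(w) - c w^k / k!\<close> is bounded by the supremum of the \<open>k\<close>-th derivative, and the induction replaces one derivative
  after another by a difference. The constant \<open>c\<close> is carried along so that the lemma compares \<open>\<Delta>^k F\<close>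
  with a value of the \<open>k\<close>-th derivative and does not merely bound it.
\<close>

lemma iterated_forward_diff_approx:
  fixes F :: "complex \<Rightarrow> complex"
  assumes "F holomorphic_on UNIV"
    and "\<And>w. w \<in> cball z (real k) \<Longrightarrow> norm ((deriv ^^ k) F w - c) \<le> B"
  shows "norm ((forward_diff ^^ k) F z - c) \<le> B"
  using assms
proof (induction k arbitrary: F)
  case 0
  then show ?case by simp
next
  case (Suc k)
  let ?G = "(deriv ^^ k) F"
  have G_hol: "?G holomorphic_on UNIV"
    using Suc.prems(1) by (intro holomorphic_higher_deriv) auto
  have shift_hol: "(\<lambda>w. F (w + 1)) holomorphic_on UNIV"
    using holomorphic_on_compose_gen[of "\<lambda>w. w + 1" UNIV F UNIV] Suc.prems(1)
    by (simp add: o_def holomorphic_intros)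
  have "norm ((forward_diff ^^ k) (forward_diff F) z - c) \<le> B"
  proof (rule Suc.IH)
    show "forward_diff F holomorphic_on UNIV"
      unfolding forward_diff_def using shift_hol Suc.prems(1) by (intro holomorphic_on_diff)
  next
    fix w assume w: "w \<in> cball z (real k)"
    have "(deriv ^^ k) (forward_diff F) w = (deriv ^^ k) (\<lambda>w. F (w + 1)) w - ?G w"
      unfolding forward_diff_def
      by (rule higher_deriv_diff[OF shift_hol Suc.prems(1)]) auto
    also have "(deriv ^^ k) (\<lambda>w. F (w + 1)) w = ?G (w + 1)"
      using higher_deriv_compose_linear'[OF Suc.prems(1), of UNIV w 1 1 k] by simp
    finally have diff: "(deriv ^^ k) (forward_diff F) w - c
        = (\<lambda>u. ?G u - c * u) (w + 1) - (\<lambda>u. ?G u - c * u) w"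
      by (simp add: algebra_simps)
    have "norm ((\<lambda>u. ?G u - c * u) (w + 1) - (\<lambda>u. ?G u - c * u) w) \<le> B * norm (w + 1 - w)"
    proof (rule field_differentiable_bound[of "cball z (real (Suc k))" _
            "\<lambda>u. (deriv ^^ Suc k) F u - c"])
      fix u assume "u \<in> cball z (real (Suc k))"
      have "(?G has_field_derivative (deriv ^^ Suc k) F u) (at u)"
        using holomorphic_derivI[OF G_hol, of u] by simp
      then have "((\<lambda>u. ?G u - c * u) has_field_derivative (deriv ^^ Suc k) F u - c) (at u)"
        by (intro DERIV_diff DERIV_cmult_Id)
      then show "((\<lambda>u. ?G u - c * u) has_field_derivative (deriv ^^ Suc k) F u - c)
          (at u within cball z (real (Suc k)))"
        by (rule has_field_derivative_at_within)
    next
      have "norm (z - (w + 1)) \<le> norm (z - w) + norm (1 :: complex)"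
        using norm_triangle_ineq4[of "z - w" 1] by (simp add: algebra_simps)
      then show "w + 1 \<in> cball z (real (Suc k))"
        using w by (simp add: dist_norm)
    qed (use w Suc.prems(2) in \<open>auto simp: dist_norm\<close>)
    with diff show "norm ((deriv ^^ k) (forward_diff F) w - c) \<le> B"
      by simp
  qed
  then show ?case
    by (simp add: funpow_swap1)
qed

section \<open>The exceptional set\<close>

text \<open>
  The crude bound \<open>1 / r \<le> q / X\<close> on the interval is enough: for \<open>q = 1 + O(h)\<close> the measure is \<open>O(h)\<close>.
  For \<open>X \<le> 0\<close> the interval does not meet \<open>{1<..}\<close>.
\<close>

lemma log_measure_interval:
  fixes X q :: real
  assumes "q > 1"
  shows "emeasure (density lborel (\<lambda>r. ennreal (1 / r) * indicator {1<..} r)) {X / q..X * q}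
    \<le> ennreal (q ^ 2 - 1)"
proof (cases "X > 0")
  case True
  let ?I = "{X / q..X * q}"
  have le: "X / q \<le> X * q"
  proof -
    have "X / q \<le> X" "X \<le> X * q"
      using True assms by (auto simp: field_simps)
    then show ?thesis by linarith
  qed
  have "emeasure (density lborel (\<lambda>r. ennreal (1 / r) * indicator {1<..} r)) ?I
      = (\<integral>\<^sup>+ r. ennreal (1 / r) * indicator {1<..} r * indicator ?I r \<partial>lborel)"
    by (rule emeasure_density) auto
  also have "\<dots> \<le> (\<integral>\<^sup>+ r. ennreal (q / X) * indicator ?I r \<partial>lborel)"
  proof (rule nn_integral_mono)
    fix r :: real
    show "ennreal (1 / r) * indicator {1<..} r * indicator ?I r \<le> ennreal (q / X) * indicator ?I r"
      using True assms
      by (auto simp: indicator_def intro!: ennreal_leI simp: field_simps)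
  qed
  also have "\<dots> = ennreal (q / X) * ennreal (X * q - X / q)"
    using le by (simp add: nn_integral_cmult_indicator)
  also have "\<dots> = ennreal (q ^ 2 - 1)"
    using True assms le by (subst ennreal_mult[symmetric]) (auto simp: field_simps power2_eq_square)
  finally show ?thesis .
next
  case False
  have "emeasure (density lborel (\<lambda>r. ennreal (1 / r) * indicator {1<..} r)) {X / q..X * q} =
     (\<integral>\<^sup>+ r. ennreal (1 / r) * indicator {1<..} r * indicator {X / q..X * q} r \<partial>lborel)"
    by (rule emeasure_density) auto
  also have "\<dots> = (\<integral>\<^sup>+ r. 0 \<partial>(lborel :: real measure))"
  proof (rule nn_integral_cong)
    fix r :: real
    have "X * q \<le> 0" using False assms by (simp add: mult_le_0_iff)
    then show "ennreal (1 / r) * indicator {1<..} r * indicator {X / q..X * q} r = 0"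
      by (auto simp: indicator_def)
  qed
  finally show ?thesis by simp
qed

text \<open>
  Turns the logarithmic measure into an honest measure, for which countable subadditivity is available.
\<close>

lemma finite_log_measure_iff_density:
  assumes "E \<in> sets borel"
  shows "finite_log_measure E \<longleftrightarrow>
    emeasure (density lborel (\<lambda>r. ennreal (1 / r) * indicator {1<..} r)) E < \<infinity>"
proof -
  have "(\<integral>\<^sup>+ r \<in> E \<inter> {1<..}. ennreal (1 / r) \<partial>lebesgue)
      = (\<integral>\<^sup>+ r \<in> E \<inter> {1<..}. ennreal (1 / r) \<partial>lborel)"
    by (intro nn_integral_completion)
  also have "\<dots> = (\<integral>\<^sup>+ r. ennreal (1 / r) * indicator {1<..} r * indicator E r \<partial>lborel)"
    by (intro nn_integral_cong) (auto simp: indicator_def)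
  also have "\<dots> = emeasure (density lborel (\<lambda>r. ennreal (1 / r) * indicator {1<..} r)) E"
    using assms by (subst emeasure_density) auto
  finally show ?thesis
    using assms by (simp add: finite_log_measure_def)
qed

lemma finite_log_measure_intervals:
  fixes X q :: "nat \<Rightarrow> real"
  assumes "\<And>j. q j > 1" and "summable (\<lambda>j. q j ^ 2 - 1)"
  shows "finite_log_measure (((\<Union>j. {X j / q j..X j * q j}) \<union> {1<..r0}) \<inter> {1<..})"
proof -
  let ?m = "density lborel (\<lambda>r. ennreal (1 / r) * indicator {1<..} r)"
  let ?U = "\<Union>j. {X j / q j..X j * q j}"
  have "emeasure ?m ?U \<le> (\<Sum>j. emeasure ?m {X j / q j..X j * q j})"
    by (rule emeasure_subadditive_countably) auto
  also have "\<dots> \<le> (\<Sum>j. ennreal (q j ^ 2 - 1))"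
    using assms(1) by (intro suminf_le log_measure_interval summableI)
  also have "\<dots> < \<infinity>"
  proof -
    have "1 \<le> q j ^ 2" for j
      using assms(1)[of j] by (simp add: one_le_power less_imp_le)
    then show ?thesis
      using assms(2) by (subst suminf_ennreal2) auto
  qed
  finally have U: "emeasure ?m ?U < \<infinity>" .
  define q0 where "q0 = max 2 r0"
  have "emeasure ?m {1 / q0..1 * q0} \<le> ennreal (q0 ^ 2 - 1)"
    by (rule log_measure_interval) (simp add: q0_def)
  moreover have "emeasure ?m {1<..r0} \<le> emeasure ?m {1 / q0..1 * q0}"
  proof (rule emeasure_mono)
    have "1 / q0 \<le> 1" "r0 \<le> q0" by (simp_all add: q0_def)
    then show "{1<..r0} \<subseteq> {1 / q0..1 * q0}"
      unfolding subset_iff greaterThanAtMost_iff atLeastAtMost_iff by linarith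
  qed auto
  ultimately have "emeasure ?m {1<..r0} \<le> ennreal (q0 ^ 2 - 1)" by (rule order_trans[rotated])
  then have I: "emeasure ?m {1<..r0} < \<infinity>"
    using le_less_trans[OF _ ennreal_less_top] by simp
  have "emeasure ?m ((?U \<union> {1<..r0}) \<inter> {1<..}) \<le> emeasure ?m (?U \<union> {1<..r0})"
    by (rule emeasure_mono) auto
  also have "\<dots> \<le> emeasure ?m ?U + emeasure ?m {1<..r0}"
    by (rule emeasure_subadditive) auto
  also have "\<dots> < \<infinity>"
    using U I by simp
  finally show ?thesis
    by (subst finite_log_measure_iff_density) auto
qed

text \<open>
  Its square is the factor by which a radius may be changed while the central index stays between the
  cubes of \<open>i\<close> and \<open>i + 1\<close>. Cubes and inverse squares are matched: the gap between the cubes is \<open>O((i + 1)^2)\<close>, so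
  that a power of the ratio with an exponent of that size is bounded, and inverse squares are still summable.
\<close>

definition gap_ratio :: "nat \<Rightarrow> real" where
  "gap_ratio i = 1 + 1 / real (i + 1) ^ 2"

text \<open>
  A Borel-Nevanlinna growth lemma. The jump points are \<open>X\<^sub>j\<close>, where \<open>v\<close> first reaches \<open>j^3\<close>. If a
  radius with \<open>i^3 \<le> v(r) < (i + 1)^3\<close> avoids the intervals around \<open>X\<^sub>i\<close> and \<open>X\<^sub>i\<^sub>+\<^sub>1\<close>, then it is separated
  from both jumps by the widths of these intervals, which is room to move in both directions. Here \<open>r0\<close>
  allows a finite initial range to be discarded as well.
\<close>

lemma monotone_slow_growth:
  fixes v :: "real \<Rightarrow> nat"
  assumes mono: "\<And>x y. 0 < x \<Longrightarrow> x \<le> y \<Longrightarrow> v x \<le> v y"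
    and unbounded: "\<And>n. \<exists>r>0. n \<le> v r"
  obtains E where "E \<subseteq> {1<..}" "finite_log_measure E" "{1<..r0} \<subseteq> E"
    "\<And>r. r > 1 \<Longrightarrow> r \<notin> E \<Longrightarrow> v r \<ge> 1 \<Longrightarrow>
      \<exists>i. i ^ 3 \<le> v (r / gap_ratio i ^ 2) \<and> v (r * gap_ratio i ^ 2) < (i + 1) ^ 3"
proof -
  define X where "X j = Inf {r. 0 < r \<and> j ^ 3 \<le> v r}" for j
  define p where "p j = 1 + 1 / real (Suc j) ^ 2" for j
  define q where "q j = p j ^ 2" for j
  \<comment> \<open>The index is shifted to avoid a division by zero: \<open>p j\<close> belongs to the jump \<open>X (Suc j)\<close>.\<close>
  define E where "E = ((\<Union>j. {X (Suc j) / q j..X (Suc j) * q j}) \<union> {1<..r0}) \<inter> {1<..}"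
  have p_gt: "1 < p j" for j by (simp add: p_def)
  have q_gt: "1 < q j" for j using p_gt[of j] by (simp add: q_def one_less_power)
  have above: "j ^ 3 \<le> v r" if "X j < r" for j r
  proof -
    have "\<exists>s\<in>{r. 0 < r \<and> j ^ 3 \<le> v r}. s < r"
    proof -
      have "{r. 0 < r \<and> j ^ 3 \<le> v r} \<noteq> {}"
        using unbounded[of "j ^ 3"] by simp
      from cInf_lessD[OF this that[unfolded X_def]] show ?thesis .
    qed
    then obtain s where "0 < s" "j ^ 3 \<le> v s" "s < r" by blast
    then show ?thesis using mono[of s r] by simp
  qed
  have below: "v r < j ^ 3" if "0 < r" "r < X j" for j r
  proof (rule ccontr)
    assume "\<not> ?thesis"
    then have "X j \<le> r"
      unfolding X_def using that by (intro cInf_lower) (auto intro!: bdd_belowI[of _ 0])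
    then show False using that by simp
  qed
  have "summable (\<lambda>j. q j ^ 2 - 1)"
  proof (rule summable_comparison_test')
    show "summable (\<lambda>j. 15 * (1 / real (Suc j) ^ 2))"
      using inverse_squares_sums by (intro summable_mult) (auto simp: sums_iff)
    fix j :: nat
    define x where "x = 1 / real (Suc j) ^ 2"
    have x: "0 \<le> x" "x \<le> 1" by (auto simp: x_def)
    have "x ^ 2 \<le> x" "x ^ 3 \<le> x" "x ^ 4 \<le> x"
      using x power_decreasing[of 1 _ x] by auto
    then have "(1 + x) ^ 4 - 1 \<le> 15 * x"
      by (simp add: power4_eq_xxxx power3_eq_cube power2_eq_square algebra_simps)
    moreover have "1 \<le> (1 + x) ^ 4" using x by (intro one_le_power) simp
    ultimately show "norm (q j ^ 2 - 1) \<le> 15 * (1 / real (Suc j) ^ 2)"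
      by (simp add: q_def p_def x_def flip: power_mult)
  qed
  then have "finite_log_measure E"
    unfolding E_def using q_gt by (intro finite_log_measure_intervals)
  moreover have "\<exists>i. i ^ 3 \<le> v (r / gap_ratio i ^ 2) \<and> v (r * gap_ratio i ^ 2) < (i + 1) ^ 3"
    if r: "r > 1" "r \<notin> E" "v r \<ge> 1" for r
  proof -
    define i where "i = (GREATEST i. i ^ 3 \<le> v r)"
    have bound: "\<forall>y. y ^ 3 \<le> v r \<longrightarrow> y \<le> v r"
    proof (intro allI impI)
      fix y assume y: "y ^ 3 \<le> v r"
      have "y \<le> y ^ 3" by (cases "y = 0") (auto intro: self_le_power)
      with y show "y \<le> v r" by simp
    qed
    have i1: "i ^ 3 \<le> v r"
      unfolding i_def by (rule GreatestI_nat[of _ 1 "v r"]) (use r(3) bound in auto)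
    have i_ge: "1 \<le> i"
      unfolding i_def by (rule Greatest_le_nat[of _ _ "v r"]) (use r(3) bound in auto)
    have i2: "v r < (i + 1) ^ 3"
    proof (rule ccontr)
      assume "\<not> ?thesis"
      then have "i + 1 \<le> i"
        unfolding i_def by (intro Greatest_le_nat[of _ _ "v r"]) (use bound in auto)
      then show False by simp
    qed
    obtain j where j: "i = Suc j" using i_ge by (cases i) auto
    have out: "r < X (Suc l) / q l \<or> X (Suc l) * q l < r" for l
      using r(1,2) by (auto simp: E_def not_le)
    \<comment> \<open>The interval around the lower jump is the wider one, so the upper ratio \<open>q i\<close> works on both sides.\<close>
    have q_anti: "q i \<le> q j"
      unfolding q_def p_def j by (intro power_mono add_left_mono divide_left_mono) auto
    have "X i * q j < r"
    proof -
      have "\<not> r < X i / q j"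
      proof
        assume "r < X i / q j"
        moreover have "0 < X i"
          using calculation r(1) q_gt[of j] by (smt (verit) divide_nonpos_pos)
        then have "X i / q j \<le> X i"
          using q_gt[of j] by (simp add: field_simps)
        ultimately have "r < X i" by linarith
        then show False using below[of r i] r(1) i1 by simp
      qed
      then show ?thesis using out[of j] j by auto
    qed
    then have "X i < r / q j" using q_gt[of j] by (simp add: field_simps)
    also have "\<dots> \<le> r / q i"
      using q_anti q_gt[of i] q_gt[of j] r(1) by (intro divide_left_mono mult_pos_pos) linarith+
    finally have low: "i ^ 3 \<le> v (r / q i)" by (rule above)
    have "r < X (Suc i) / q i"
    proof -
      have "\<not> X (Suc i) * q i < r"
      proof
        assume a: "X (Suc i) * q i < r"
        have "0 \<le> X (Suc i)"
          unfolding X_def using unbounded[of "Suc i ^ 3"] by (intro cInf_greatest) auto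
        then have "X (Suc i) \<le> X (Suc i) * q i"
          using q_gt[of i] by (simp add: mult_le_cancel_left1)
        then have "X (Suc i) < r" using a by linarith
        then show False using above[of "Suc i" r] i2 by simp
      qed
      then show ?thesis using out[of i] by auto
    qed
    then have "r * q i < X (Suc i)" using q_gt[of i] by (simp add: field_simps)
    moreover have "0 < r * q i"
      using r(1) q_gt[of i] by simp
    ultimately have "v (r * q i) < (i + 1) ^ 3"
      using below by simp
    with low show ?thesis
      by (intro exI[of _ i]) (simp add: q_def p_def gap_ratio_def)
  qed
  ultimately show ?thesis
    by (intro that[of E]) (auto simp: E_def)
qed

section \<open>Comparison with an exponential near a point\<close>

lemma higher_deriv_exp_linear:
  "(deriv ^^ k) (\<lambda>w. exp (c * w)) = (\<lambda>w. c ^ k * exp (c * w :: complex))"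
proof (induction k)
  case (Suc k)
  have "((\<lambda>w. c ^ k * exp (c * w)) has_field_derivative c ^ Suc k * exp (c * w)) (at w)" for w
    by (auto intro!: derivative_eq_intros)
  then show ?case
    using Suc by (auto intro!: DERIV_imp_deriv)
qed simp

text \<open>
  Since \<open>\<bar>1 + \<zeta>\<bar>\<^sup>2 = 1 + 2 Re \<zeta> + \<bar>\<zeta>\<bar>\<^sup>2\<close>, replacing \<open>(1 + \<zeta>)^n\<close> by \<open>exp(n \<zeta>)\<close> costs only the factor
  \<open>exp(n \<bar>\<zeta>\<bar>\<^sup>2 / 2)\<close>, which is bounded for \<open>\<bar>\<zeta>\<bar> = O(n^(- 1/2))\<close>.
\<close>

lemma norm_one_plus_power_le:
  fixes \<zeta> :: complex
  shows "norm (1 + \<zeta>) ^ n \<le> exp (real n * (Re \<zeta> + norm \<zeta> ^ 2 / 2))"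
proof -
  have "norm (1 + \<zeta>) ^ 2 = 1 + (2 * Re \<zeta> + norm \<zeta> ^ 2)"
    unfolding cmod_power2 by (simp add: power2_eq_square algebra_simps)
  also have "\<dots> \<le> exp (2 * Re \<zeta> + norm \<zeta> ^ 2)"
    by (rule exp_ge_add_one_self)
  also have "\<dots> = exp (Re \<zeta> + norm \<zeta> ^ 2 / 2) ^ 2"
    by (simp flip: exp_of_nat_mult)
  finally have "norm (1 + \<zeta>) \<le> exp (Re \<zeta> + norm \<zeta> ^ 2 / 2)"
    by (rule power2_le_imp_le) simp
  then have "norm (1 + \<zeta>) ^ n \<le> exp (Re \<zeta> + norm \<zeta> ^ 2 / 2) ^ n"
    by (intro power_mono) auto
  then show ?thesis
    by (simp flip: exp_of_nat_mult)
qed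

text \<open>
  Two applications of Cauchy's estimates on shrinking discs. The growth hypothesis bounds
  \<open>g(w) = f(z + w) exp(- N w / z)\<close> by \<open>e B\<close> for \<open>\<bar>w\<bar> \<le> r / (4 L)\<close>, where \<open>N \<le> L\<^sup>2\<close> controls the replacement of
  \<open>(1 + w / z)^N\<close> by \<open>exp(N w / z)\<close>. Hence \<open>g\<close> has a Lipschitz constant \<open>O(L B / r)\<close> on half that disc, and
  \<open>H(w) = f(z + w) - f(z) exp(N w / z)\<close> is \<open>O(L B / N)\<close> for \<open>\<bar>w\<bar> \<le> r / N\<close>, where the exponential is
  bounded. Discs of radius \<open>r / (2 N)\<close> then give the \<open>k\<close>-th derivative of \<open>H\<close> for \<open>\<bar>w\<bar> \<le> k\<close>.
\<close>

lemma forward_diff_local_comparison: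
  fixes f :: "complex \<Rightarrow> complex" and N L k :: nat and r B :: real
  assumes f: "f holomorphic_on UNIV"
    and z: "norm z = r" and r: "r > 0" and B: "B \<ge> 0"
    and NL: "1 \<le> L" "N \<le> L ^ 2" "8 * L \<le> N" and Nr: "2 * real k * real N \<le> r"
    and growth: "\<And>u \<rho>. norm u = r * \<rho> \<Longrightarrow> \<bar>\<rho> - 1\<bar> \<le> 1 / (4 * real L) \<Longrightarrow>
      norm (f u) \<le> B * \<rho> ^ N * max \<rho> (1 / \<rho>) ^ L"
  shows "norm ((forward_diff ^^ k) f z - f z * (of_nat N / z) ^ k)
    \<le> (real N / r) ^ k * (fact k * 2 ^ k * (8 * exp 2) * (real L / real N) * B
        + 3 / 2 * real k * (real N / r) * norm (f z))"
proof -
  let ?c = "of_nat N / z"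
  define g where "g w = f (z + w) * exp (- ?c * w)" for w
  define H where "H w = f (z + w) - f z * exp (?c * w)" for w
  have z0: "z \<noteq> 0" using z r by auto
  have N0: "N > 0" using NL by linarith
  have shift: "(\<lambda>w. f (z + w)) holomorphic_on UNIV"
    using holomorphic_on_compose_gen[of "\<lambda>w. z + w" UNIV f UNIV] f
    by (simp add: o_def holomorphic_intros)
  have g_hol: "g holomorphic_on UNIV" and H_hol: "H holomorphic_on UNIV"
    unfolding g_def H_def using z0 by (intro holomorphic_intros shift)+ auto
  have norm_c: "norm (?c * w) = real N * norm w / r" for w
    using z by (simp add: norm_mult norm_divide)

  have g_bound: "norm (g w) \<le> exp 1 * B" if w: "norm w \<le> r / (4 * real L)" for w
  proof -
    define \<zeta> where "\<zeta> = w / z"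
    define \<rho> where "\<rho> = norm (1 + \<zeta>)"
    have \<zeta>: "norm \<zeta> \<le> 1 / (4 * real L)"
      using w r z by (simp add: \<zeta>_def norm_divide field_simps)
    also have "\<dots> \<le> 1 / 4"
      using NL by (simp add: field_simps)
    finally have \<zeta>4: "norm \<zeta> \<le> 1 / 4" .
    have up: "\<rho> \<le> 1 + norm \<zeta>" and low: "1 - norm \<zeta> \<le> \<rho>"
      unfolding \<rho>_def using norm_triangle_ineq[of 1 \<zeta>] norm_triangle_ineq2[of 1 "- \<zeta>"] by auto
    have \<rho>_pos: "\<rho> > 0" using low \<zeta>4 by linarith
    have "z + w = z * (1 + \<zeta>)" using z0 by (simp add: \<zeta>_def field_simps)
    then have "norm (z + w) = r * \<rho>" using z by (simp add: norm_mult \<rho>_def)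
    then have "norm (f (z + w)) \<le> B * \<rho> ^ N * max \<rho> (1 / \<rho>) ^ L"
      using up low \<zeta> by (intro growth) auto
    also have "\<dots> \<le> B * exp (real N * (Re \<zeta> + norm \<zeta> ^ 2 / 2)) * exp (1 / 2)"
    proof (intro mult_mono mult_left_mono B)
      show "\<rho> ^ N \<le> exp (real N * (Re \<zeta> + norm \<zeta> ^ 2 / 2))"
        unfolding \<rho>_def by (rule norm_one_plus_power_le)
      have "0 \<le> norm \<zeta> * (1 - 2 * norm \<zeta>)"
        using \<zeta>4 by (intro mult_nonneg_nonneg) auto
      then have "1 \<le> (1 + 2 * norm \<zeta>) * (1 - norm \<zeta>)"
        by (simp add: algebra_simps)
      also have "\<dots> \<le> (1 + 2 * norm \<zeta>) * \<rho>"
        using low by (intro mult_left_mono) auto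
      finally have "1 / \<rho> \<le> 1 + 2 * norm \<zeta>"
        using \<rho>_pos by (simp add: field_simps)
      then have "max \<rho> (1 / \<rho>) \<le> 1 + 2 * norm \<zeta>"
        using up norm_ge_zero[of \<zeta>] by (intro max.boundedI) linarith+
      also have "\<dots> \<le> exp (2 * norm \<zeta>)" by (rule exp_ge_add_one_self)
      finally have "max \<rho> (1 / \<rho>) ^ L \<le> exp (2 * norm \<zeta>) ^ L"
        using \<rho>_pos by (intro power_mono) (auto simp: le_max_iff_disj)
      also have "\<dots> = exp (real L * (2 * norm \<zeta>))" by (simp flip: exp_of_nat_mult)
      also have "real L * (2 * norm \<zeta>) \<le> 1 / 2"
        using \<zeta> NL by (simp add: field_simps)
      finally show "max \<rho> (1 / \<rho>) ^ L \<le> exp (1 / 2)" by simp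
    qed (use \<rho>_pos B in auto)
    finally have f_le: "norm (f (z + w)) \<le> B * exp (real N * (Re \<zeta> + norm \<zeta> ^ 2 / 2)) * exp (1 / 2)" .
    have "- ?c * w = - (of_nat N * \<zeta>)" by (simp add: \<zeta>_def)
    then have "norm (exp (- ?c * w)) = exp (- (real N * Re \<zeta>))" by simp
    then have "norm (g w) \<le> B * exp (real N * (Re \<zeta> + norm \<zeta> ^ 2 / 2)) * exp (1 / 2) * exp (- (real N * Re \<zeta>))"
      using f_le by (simp add: g_def norm_mult mult_right_mono)
    also have "\<dots> = B * exp (real N * norm \<zeta> ^ 2 / 2 + 1 / 2)"
      by (simp add: algebra_simps flip: exp_add)
    also have "\<dots> \<le> B * exp 1"
    proof -
      have "real N * norm \<zeta> ^ 2 \<le> real (L ^ 2) * (1 / (4 * real L)) ^ 2"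
        using NL \<zeta> by (intro mult_mono power_mono of_nat_mono) auto
      also have "\<dots> \<le> 1"
        using NL by (simp add: field_simps power2_eq_square)
      finally show ?thesis using B by (intro mult_left_mono) auto
    qed
    finally show ?thesis by (simp add: mult.commute)
  qed

  have g_lip: "norm (g w - g 0) \<le> 8 * exp 1 * real L * B / r * norm (w - 0)"
    if w: "norm w \<le> r / (8 * real L)" for w
  proof (rule field_differentiable_bound[of "cball 0 (r / (8 * real L))" g "deriv g"])
    fix x :: complex assume x: "x \<in> cball 0 (r / (8 * real L))"
    show "(g has_field_derivative deriv g x) (at x within cball 0 (r / (8 * real L)))"
      using holomorphic_derivI[OF g_hol, of x] by (simp add: has_field_derivative_at_within)
    have "norm ((deriv ^^ 1) g x) \<le> fact 1 * (exp 1 * B) / (r / (8 * real L)) ^ 1"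
    proof (rule Cauchy_inequality)
      fix y :: complex assume y: "norm (x - y) = r / (8 * real L)"
      have "norm y \<le> norm x + norm (x - y)"
        using norm_triangle_ineq4[of x "x - y"] by simp
      also have "\<dots> \<le> r / (4 * real L)"
        using x y by simp
      finally show "norm (g y) \<le> exp 1 * B" by (rule g_bound)
    qed (use r NL g_hol holomorphic_on_subset holomorphic_on_imp_continuous_on in \<open>auto simp: continuous_on_subset\<close>)
    then show "norm (deriv g x) \<le> 8 * exp 1 * real L * B / r"
      by (simp add: field_simps)
  qed (use w r in auto)

  have H_bound: "norm (H w) \<le> 8 * exp 2 * real L * B / real N" if w: "norm w \<le> r / real N" for w
  proof -
    have "r / real N \<le> r / (8 * real L)"
      using NL N0 r by (intro divide_left_mono) auto
    then have "norm (g w - g 0) \<le> 8 * exp 1 * real L * B / r * norm w"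
      using g_lip[of w] w by simp
    also have "\<dots> \<le> 8 * exp 1 * real L * B / r * (r / real N)"
      using w r B by (intro mult_left_mono) auto
    finally have 1: "norm (g w - g 0) \<le> 8 * exp 1 * real L * B / real N"
      using r by simp
    have "norm (exp (?c * w)) \<le> exp (norm (?c * w))" by (rule norm_exp)
    also have "\<dots> \<le> exp 1"
      using w N0 r unfolding norm_c by (simp add: field_simps)
    finally have 2: "norm (exp (?c * w)) \<le> exp 1" .
    have "H w = exp (?c * w) * (g w - g 0)"
      by (simp add: H_def g_def algebra_simps exp_minus)
    then have "norm (H w) \<le> exp 1 * (8 * exp 1 * real L * B / real N)"
      using mult_mono[OF 2 1] by (simp add: norm_mult)
    also have "\<dots> = 8 * exp 2 * real L * B / real N"
      using exp_add[of 1 "1 :: real"] by simp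
    finally show ?thesis .
  qed

  have H_deriv: "norm ((deriv ^^ k) H w) \<le> fact k * (8 * exp 2 * real L * B / real N) / (r / (2 * real N)) ^ k"
    if w: "norm w \<le> real k" for w
  proof (rule Cauchy_inequality)
    fix y :: complex assume y: "norm (w - y) = r / (2 * real N)"
    have "norm y \<le> norm w + norm (w - y)"
      using norm_triangle_ineq4[of w "w - y"] by simp
    also have "\<dots> \<le> r / (2 * real N) + r / (2 * real N)"
    proof -
      have "real k \<le> r / (2 * real N)" using Nr N0 by (simp add: field_simps)
      then show ?thesis using y w by simp
    qed
    also have "\<dots> = r / real N" by simp
    finally show "norm (H y) \<le> 8 * exp 2 * real L * B / real N" by (rule H_bound)
  qed (use r N0 H_hol holomorphic_on_subset holomorphic_on_imp_continuous_on in \<open>auto simp: continuous_on_subset\<close>)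

  show ?thesis
  proof (rule iterated_forward_diff_approx[OF f])
    fix u assume u: "u \<in> cball z (real k)"
    define w where "w = u - z"
    have w: "norm w \<le> real k" using u by (simp add: w_def dist_norm norm_minus_commute)
    have "(deriv ^^ k) H w = (deriv ^^ k) (\<lambda>w. f (z + w)) w - (deriv ^^ k) (\<lambda>w. f z * exp (?c * w)) w"
      unfolding H_def by (rule higher_deriv_diff[of _ UNIV]) (use z0 in \<open>auto intro!: holomorphic_intros shift\<close>)
    also have "(deriv ^^ k) (\<lambda>w. f (z + w)) w = (deriv ^^ k) f u"
      using higher_deriv_compose_linear'[OF f, of UNIV w 1 z k] by (simp add: w_def add.commute)
    also have "(deriv ^^ k) (\<lambda>w. f z * exp (?c * w)) w = f z * (deriv ^^ k) (\<lambda>w. exp (?c * w)) w"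
      by (rule higher_deriv_cmult[of _ UNIV]) (auto intro!: holomorphic_intros simp: z0)
    also have "\<dots> = f z * (?c ^ k * exp (?c * w))"
      by (simp only: higher_deriv_exp_linear)
    finally have "(deriv ^^ k) f u - f z * ?c ^ k
        = (deriv ^^ k) H w + f z * ?c ^ k * (exp (?c * w) - 1)"
      by (simp add: algebra_simps)
    then have "norm ((deriv ^^ k) f u - f z * ?c ^ k)
        \<le> norm ((deriv ^^ k) H w) + norm (f z * ?c ^ k * (exp (?c * w) - 1))"
      using norm_triangle_ineq by metis
    also have "norm (f z * ?c ^ k * (exp (?c * w) - 1)) \<le> norm (f z) * (real N / r) ^ k * (3 / 2 * (real k * real N / r))"
    proof -
      have cw: "norm (?c * w) \<le> real k * real N / r"
        using w r unfolding norm_c by (simp add: field_simps mult_left_mono)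
      also have "\<dots> \<le> 1 / 2" using Nr r by (simp add: field_simps)
      finally have "norm (exp (?c * w) - 1) \<le> 3 / 2 * norm (?c * w)"
        by (rule norm_exp_bounds(2))
      also have "\<dots> \<le> 3 / 2 * (real k * real N / r)" using cw by (rule mult_left_mono) simp
      finally have "norm (f z) * (real N / r) ^ k * norm (exp (?c * w) - 1)
          \<le> norm (f z) * (real N / r) ^ k * (3 / 2 * (real k * real N / r))"
        using r by (intro mult_left_mono) auto
      then show ?thesis
        using z by (simp only: norm_mult norm_power norm_divide norm_of_nat)
    qed
    also note H_deriv[OF w]
    also have "fact k * (8 * exp 2 * real L * B / real N) / (r / (2 * real N)) ^ k
        + norm (f z) * (real N / r) ^ k * (3 / 2 * (real k * real N / r))
      = (real N / r) ^ k * (fact k * 2 ^ k * (8 * exp 2) * (real L / real N) * B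
        + 3 / 2 * real k * (real N / r) * norm (f z))"
      using r N0 by (simp add: power_divide power_mult_distrib field_simps)
    finally show "norm ((deriv ^^ k) f u - f z * ?c ^ k) \<le> \<dots>" by simp
  qed
qed

section \<open>Maximal term and central index\<close>

locale transcendental_function =
  fixes f :: "complex \<Rightarrow> complex"
  assumes transcendental: "transcendental_entire f"
begin

abbreviation a :: "nat \<Rightarrow> real" where
  "a n \<equiv> norm (fps_nth (fps_expansion f 0) n)"

abbreviation M :: "real \<Rightarrow> real" where "M r \<equiv> max_modulus r f"
abbreviation \<mu> :: "real \<Rightarrow> real" where "\<mu> r \<equiv> max_term r f"
abbreviation \<nu> :: "real \<Rightarrow> nat" where "\<nu> r \<equiv> central_index r f"

lemma holomorphic: "f holomorphic_on UNIV"
  using transcendental by (simp add: transcendental_entire_def)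

lemma continuous: "continuous_on S f"
  by (meson continuous_on_subset holomorphic holomorphic_on_imp_continuous_on subset_UNIV)

lemma expansion_sums: "(\<lambda>n. fps_nth (fps_expansion f 0) n * z ^ n) sums f z"
proof -
  have "z \<in> ball 0 (norm z + 1)" by simp
  then show ?thesis
    using holomorphic_power_series[of f 0 "norm z + 1" z] holomorphic_on_subset[OF holomorphic]
    by (simp add: fps_expansion_def)
qed

lemma summable_terms:
  assumes "r \<ge> 0"
  shows "summable (\<lambda>n. a n * r ^ n)"
proof -
  have "summable (\<lambda>n. norm (fps_nth (fps_expansion f 0) n * of_real r ^ n))"
    using expansion_sums[of "of_real (r + 1)"] assms
    by (intro powser_insidea[of _ "of_real (r + 1)"]) (auto simp: sums_iff)
  then show ?thesis
    using assms by (simp add: norm_mult norm_power)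
qed

lemma terms_tendsto_0: "r \<ge> 0 \<Longrightarrow> (\<lambda>n. a n * r ^ n) \<longlonglongrightarrow> 0"
  by (rule summable_LIMSEQ_zero[OF summable_terms])

text \<open>
  Otherwise the expansion would be a polynomial. This is what makes the maximal term positive and the
  central index tend to infinity.
\<close>

lemma infinitely_many_coeffs: "\<exists>n>m. a n > 0"
proof (rule ccontr)
  assume "\<not> ?thesis"
  then have zero: "fps_nth (fps_expansion f 0) n = 0" if "n > m" for n
    using that by auto
  have "f = poly (\<Sum>n\<le>m. monom (fps_nth (fps_expansion f 0) n) n)"
  proof
    fix z
    have "f z = (\<Sum>n. fps_nth (fps_expansion f 0) n * z ^ n)"
      using expansion_sums[of z] by (simp add: sums_iff)
    also have "\<dots> = (\<Sum>n\<le>m. fps_nth (fps_expansion f 0) n * z ^ n)"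
      by (rule suminf_finite) (use zero in \<open>auto simp: not_le\<close>)
    finally show "f z = poly (\<Sum>n\<le>m. monom (fps_nth (fps_expansion f 0) n) n) z"
      by (simp add: poly_sum poly_monom)
  qed
  then show False
    using transcendental unfolding transcendental_entire_def by blast
qed

lemma finitely_many_large_terms:
  assumes "r \<ge> 0" "t > 0"
  obtains b where "\<And>n. a n * r ^ n \<ge> t \<Longrightarrow> n < b"
proof -
  have "eventually (\<lambda>n. a n * r ^ n < t) sequentially"
    using order_tendstoD(2)[OF terms_tendsto_0[OF assms(1)] assms(2)] .
  then obtain b where "\<And>n. n \<ge> b \<Longrightarrow> a n * r ^ n < t"
    by (auto simp: eventually_sequentially)
  then show ?thesis
    by (intro that[of b]) (meson not_le)
qed

lemma term_le_max_term:
  assumes "r \<ge> 0"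
  shows "a n * r ^ n \<le> \<mu> r"
  unfolding max_term_def
  using convergent_imp_Bseq[OF convergentI[OF terms_tendsto_0[OF assms]]]
  by (intro cSUP_upper bounded_imp_bdd_above) (auto simp: Bseq_eq_bounded)

lemma max_term_pos:
  assumes "r > 0"
  shows "\<mu> r > 0"
proof -
  obtain n where "a n > 0" using infinitely_many_coeffs[of 0] by blast
  then have "0 < a n * r ^ n" using assms by simp
  also have "\<dots> \<le> \<mu> r" using assms by (intro term_le_max_term) simp
  finally show ?thesis .
qed

lemma max_term_attained:
  assumes "r > 0"
  shows "\<exists>n. a n * r ^ n = \<mu> r"
proof -
  obtain m where m: "a m > 0" using infinitely_many_coeffs[of 0] by blast
  obtain b where b: "\<And>n. a n * r ^ n \<ge> a m * r ^ m \<Longrightarrow> n < b"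
    using finitely_many_large_terms[of r "a m * r ^ m"] m assms by auto
  have fin: "finite ((\<lambda>n. a n * r ^ n) ` {..<b})" (is "finite ?T") by simp
  have mb: "m < b" using b by blast
  then have ne: "?T \<noteq> {}" by auto
  obtain n where n: "n < b" "a n * r ^ n = Max ?T"
    using Max_in[OF fin ne] by auto
  have "\<mu> r \<le> Max ?T"
    unfolding max_term_def
  proof (rule cSUP_least)
    fix l
    show "a l * r ^ l \<le> Max ?T"
    proof (cases "l < b")
      case True
      then show ?thesis using fin by (intro Max_ge) auto
    next
      case False
      then have "a l * r ^ l \<le> a m * r ^ m" using b[of l] by linarith
      also have "\<dots> \<le> Max ?T" using mb fin by (intro Max_ge) auto
      finally show ?thesis .
    qed
  qed simp
  then show ?thesis
    using n(2) term_le_max_term[of r n] assms by (intro exI[of _ n]) simp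
qed

lemma central_index_maximal:
  assumes "r > 0"
  shows "a (\<nu> r) * r ^ \<nu> r = \<mu> r"
    and "n > \<nu> r \<Longrightarrow> a n * r ^ n < \<mu> r"
proof -
  obtain b where b: "\<And>n. a n * r ^ n \<ge> \<mu> r \<Longrightarrow> n < b"
    using finitely_many_large_terms[of r "\<mu> r"] max_term_pos assms by auto
  then have bound: "\<forall>n. a n * r ^ n = \<mu> r \<longrightarrow> n \<le> b"
    by (metis less_imp_le order_refl)
  obtain n0 where n0: "a n0 * r ^ n0 = \<mu> r"
    using max_term_attained[OF assms] by blast
  show "a (\<nu> r) * r ^ \<nu> r = \<mu> r"
    unfolding central_index_def
    using GreatestI_nat[of "\<lambda>m. a m * r ^ m = \<mu> r" n0 b] n0 bound by blast
  assume n: "n > \<nu> r"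
  have "a n * r ^ n \<noteq> \<mu> r"
  proof
    assume "a n * r ^ n = \<mu> r"
    then have "n \<le> \<nu> r"
      unfolding central_index_def
      using Greatest_le_nat[of "\<lambda>m. a m * r ^ m = \<mu> r" n b] bound by blast
    with n show False by simp
  qed
  then show "a n * r ^ n < \<mu> r"
    using term_le_max_term[of r n] assms by simp
qed

text \<open>
  Passing from \<open>x\<close> to \<open>y \<ge> x\<close> multiplies the \<open>n\<close>-th term by \<open>(y / x)^n\<close>, which favours large exponents.
\<close>

lemma central_index_mono:
  assumes "0 < x" "x \<le> y"
  shows "\<nu> x \<le> \<nu> y"
proof (rule ccontr)
  assume "\<not> ?thesis"
  then have less: "\<nu> y < \<nu> x" by simp
  have y: "0 < y" using assms by simp
  have scale: "a n * y ^ n = a n * x ^ n * (y / x) ^ n" for n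
    using assms(1) by (simp add: power_divide)
  have "\<mu> y = a (\<nu> y) * x ^ \<nu> y * (y / x) ^ \<nu> y"
    using central_index_maximal(1)[OF y] scale[of "\<nu> y"] by simp
  also have "\<dots> \<le> \<mu> x * (y / x) ^ \<nu> x"
    using assms less term_le_max_term[of x "\<nu> y"] max_term_pos[of x]
    by (intro mult_mono power_increasing) auto
  also have "\<dots> = a (\<nu> x) * y ^ \<nu> x"
    using central_index_maximal(1)[OF assms(1)] scale[of "\<nu> x"] by simp
  also have "\<dots> < \<mu> y"
    by (rule central_index_maximal(2)[OF y less])
  finally show False by simp
qed

lemma central_index_at_top: "filterlim \<nu> at_top at_top"
  unfolding filterlim_at_top
proof
  fix n
  obtain m where m: "m > n" "a m > 0" using infinitely_many_coeffs by blast
  have "eventually (\<lambda>r::real. r > max 1 (\<mu> 1 / a m)) at_top"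
    by (rule eventually_gt_at_top)
  then show "eventually (\<lambda>r. n \<le> \<nu> r) at_top"
  proof eventually_elim
    case (elim r)
    then have r: "r > 1" and big: "\<mu> 1 < a m * r"
      using m by (auto simp: field_simps)
    show ?case
    proof (rule ccontr)
      assume "\<not> ?thesis"
      then have i: "Suc (\<nu> r) \<le> m" using m by simp
      have "a m * r * r ^ \<nu> r \<le> a m * r ^ m"
        using power_increasing[OF i, of r] r m by simp
      also have "\<dots> \<le> \<mu> r" using r by (intro term_le_max_term) simp
      also have "\<dots> = a (\<nu> r) * r ^ \<nu> r" using central_index_maximal(1) r by simp
      also have "\<dots> \<le> \<mu> 1 * r ^ \<nu> r"
        using term_le_max_term[of 1 "\<nu> r"] r by (intro mult_right_mono) auto
      finally have "a m * r \<le> \<mu> 1" using r by simp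
      with big show False by simp
    qed
  qed
qed

text \<open>
  This is the convexity of \<open>log \<mu>\<close> as a function of \<open>log r\<close>, with slope \<open>\<nu>\<close>: the term that is maximal at
  \<open>r q\<close> is at most \<open>\<mu>(r)\<close> at \<open>r\<close>. It holds for \<open>q < 1\<close> as well.
\<close>

lemma max_term_dilate:
  assumes "r > 0" "q > 0"
  shows "\<mu> (r * q) \<le> \<mu> r * q ^ \<nu> (r * q)"
proof -
  have "\<mu> (r * q) = a (\<nu> (r * q)) * r ^ \<nu> (r * q) * q ^ \<nu> (r * q)"
    using central_index_maximal(1)[of "r * q"] assms by (simp add: power_mult_distrib mult.assoc)
  also have "\<dots> \<le> \<mu> r * q ^ \<nu> (r * q)"
    using assms term_le_max_term[of r] by (intro mult_right_mono) auto
  finally show ?thesis .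
qed

lemma norm_le_max_modulus: "norm (f z) \<le> M (norm z)"
proof -
  have "compact ((\<lambda>z. norm (f z)) ` sphere 0 (norm z))"
    by (intro compact_continuous_image continuous_on_norm continuous) auto
  then show ?thesis
    unfolding max_modulus_def
    by (intro cSUP_upper bounded_imp_bdd_above compact_imp_bounded) auto
qed

lemma max_term_le_max_modulus:
  assumes "r > 0"
  shows "\<mu> r \<le> M r"
proof -
  let ?n = "\<nu> r"
  have "norm ((deriv ^^ ?n) f 0) \<le> fact ?n * M r / r ^ ?n"
    using assms norm_le_max_modulus
    by (intro Cauchy_inequality holomorphic_on_subset[OF holomorphic] continuous) auto
  then have "a ?n * r ^ ?n \<le> M r"
    using assms by (simp add: fps_expansion_def norm_divide field_simps)
  then show ?thesis
    using central_index_maximal(1)[OF assms] by simp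
qed

end

section \<open>Growth near a radius that is not exceptional\<close>

text \<open>
  On natural numbers \<open>(n - N) + (N - n)\<close> is the distance of \<open>n\<close> and \<open>N\<close>.
\<close>

lemma two_sided_geometric:
  fixes x :: real
  assumes "0 \<le> x" "x < 1"
  shows "summable (\<lambda>n. x ^ ((n - N) + (N - n)))"
    and "(\<Sum>n. x ^ ((n - N) + (N - n))) \<le> 2 / (1 - x)"
proof -
  have geo: "summable (\<lambda>n. x ^ n)" "(\<Sum>n. x ^ n) = 1 / (1 - x)"
    using assms by (auto simp: summable_geometric suminf_geometric)
  have shift: "(\<lambda>n. x ^ ((n + N - N) + (N - (n + N)))) = (\<lambda>n. x ^ n)" by simp
  show summ: "summable (\<lambda>n. x ^ ((n - N) + (N - n)))"
    using geo(1) summable_iff_shift[of "\<lambda>n. x ^ ((n - N) + (N - n))" N] unfolding shift by simp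
  have "(\<Sum>n<N. x ^ ((n - N) + (N - n))) \<le> (\<Sum>n<N. x ^ (N - Suc n))"
    using assms by (intro sum_mono power_decreasing) auto
  also have "\<dots> = (\<Sum>n<N. x ^ n)"
    by (rule sum.nat_diff_reindex)
  also have "\<dots> \<le> 1 / (1 - x)"
    using sum_le_suminf[OF geo(1), of "{..<N}"] geo(2) assms by simp
  finally show "(\<Sum>n. x ^ ((n - N) + (N - n))) \<le> 2 / (1 - x)"
    using suminf_split_initial_segment[OF summ, of N] geo(2) unfolding shift
    by (simp add: add_divide_distrib[symmetric])
qed

text \<open>
  The maximum principle for \<open>f(u) / u^m\<close>. The integer exponent keeps this function
  single-valued on the annulus.
\<close>

lemma holomorphic_annulus_bound:
  fixes f :: "complex \<Rightarrow> complex"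
  assumes f: "f holomorphic_on UNIV" and r: "0 < r1"
    and inner: "\<And>u. norm u = r1 \<Longrightarrow> norm (f u) \<le> A * r1 ^ m"
    and outer: "\<And>u. norm u = r2 \<Longrightarrow> norm (f u) \<le> A * r2 ^ m"
    and u: "r1 \<le> norm u" "norm u \<le> r2"
  shows "norm (f u) \<le> A * norm u ^ m"
proof -
  let ?S = "cball 0 r2 - ball 0 r1 :: complex set"
  have nz: "w \<noteq> 0" if "w \<in> ?S" for w
    using that r by auto
  have hol: "(\<lambda>w. f w / w ^ m) holomorphic_on ?S"
    by (intro holomorphic_on_divide holomorphic_on_power holomorphic_on_ident
        holomorphic_on_subset[OF f] subset_UNIV power_not_zero nz)
  have closed: "closed ?S" by (intro closed_Diff) auto
  have "norm (f u / u ^ m) \<le> A"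
  proof (rule maximum_modulus_frontier[of "\<lambda>w. f w / w ^ m" ?S])
    show "(\<lambda>w. f w / w ^ m) holomorphic_on interior ?S"
      by (rule holomorphic_on_subset[OF hol interior_subset])
    show "continuous_on (closure ?S) (\<lambda>w. f w / w ^ m)"
      using hol closed by (simp add: holomorphic_on_imp_continuous_on)
    show "bounded ?S" by (intro bounded_diff) auto
    show "u \<in> ?S" using u by auto
    fix w assume w: "w \<in> frontier ?S"
    have in_S: "w \<in> ?S"
      using w frontier_subset_closed[OF closed] by (rule rev_subsetD)
    have "ball 0 r2 - cball 0 r1 \<subseteq> interior ?S"
      by (intro interior_maximal open_Diff) auto
    then have "w \<notin> ball 0 r2 - cball 0 r1"
      using w by (auto simp: frontier_def)
    then have "norm w = r1 \<or> norm w = r2"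
      using in_S by auto
    then have "norm (f w) \<le> A * norm w ^ m"
      using inner outer by auto
    then show "norm (f w / w ^ m) \<le> A"
      using nz[OF in_S] by (simp add: norm_divide norm_power field_simps)
  qed
  moreover have "u \<noteq> 0" using u r by auto
  ultimately show ?thesis
    by (simp add: norm_divide norm_power field_simps)
qed

context transcendental_function
begin

text \<open>
  The \<open>n\<close>-th term is at most \<open>\<mu>\<close> at the dilated radii \<open>r q\<close> (used for \<open>n \<ge> N\<close>) and \<open>r / q\<close> (used for
  \<open>n < N\<close>), and there \<open>\<mu>\<close> has changed by about \<open>q^N\<close> or \<open>q^(- N)\<close>, because \<open>\<nu>\<close> has moved by at most \<open>K\<close>.
\<close>

lemma term_decay:
  assumes r: "r > 0" and q: "q > 1"
    and hi: "\<nu> (r * q) \<le> N + K" and lo: "N \<le> \<nu> (r / q) + K"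
  shows "a n * r ^ n * q ^ ((n - N) + (N - n)) \<le> \<mu> r * q ^ K"
proof (cases "N \<le> n")
  case True
  then obtain d where d: "n = N + d" using le_Suc_ex by blast
  have "a n * r ^ n * q ^ n = a n * (r * q) ^ n" by (simp add: power_mult_distrib)
  also have "\<dots> \<le> \<mu> (r * q)"
    using r q by (intro term_le_max_term) simp
  also have "\<dots> \<le> \<mu> r * q ^ \<nu> (r * q)"
    using r q by (intro max_term_dilate) auto
  also have "\<dots> \<le> \<mu> r * q ^ (N + K)"
    using hi q max_term_pos[OF r] by (intro mult_left_mono power_increasing) auto
  finally have "q ^ N * (a n * r ^ n * q ^ d) \<le> q ^ N * (\<mu> r * q ^ K)"
    by (simp add: d power_add mult_ac)
  then show ?thesis using q d by simp
next
  case False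
  then obtain d where d: "N = n + d" using le_Suc_ex[of n N] by auto
  define m where "m = \<nu> (r * (1 / q))"
  have "a n * r ^ n * (1 / q) ^ n = a n * (r * (1 / q)) ^ n"
    by (simp only: power_mult_distrib mult.assoc)
  also have "\<dots> \<le> \<mu> (r * (1 / q))"
    using r q by (intro term_le_max_term) simp
  also have "\<dots> \<le> \<mu> r * (1 / q) ^ m"
    unfolding m_def using r q by (intro max_term_dilate) auto
  finally have m: "a n * r ^ n * q ^ m \<le> \<mu> r * q ^ n"
    using q by (simp add: power_divide field_simps)
  have "a n * r ^ n * q ^ N \<le> a n * r ^ n * q ^ (m + K)"
    using lo q r by (intro mult_left_mono power_increasing) (auto simp: m_def)
  also have "\<dots> \<le> \<mu> r * q ^ n * q ^ K"
    using mult_right_mono[OF m, of "q ^ K"] q by (simp add: power_add mult_ac)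
  finally have "q ^ n * (a n * r ^ n * q ^ d) \<le> q ^ n * (\<mu> r * q ^ K)"
    by (simp add: d power_add mult_ac)
  then show ?thesis using q d by simp
qed

text \<open>
  The terms decay like \<open>p^(- 2 \<bar>n - N\<bar>)\<close> at the radius \<open>r\<close>; moving to \<open>r \<rho>\<close> uses up at most one half of
  this exponent, and the remaining geometric series has a sum of order \<open>1 / (p - 1)\<close>.
\<close>

lemma norm_le_max_term:
  assumes r: "r > 0" and p: "p > 1"
    and hi: "\<nu> (r * p ^ 2) \<le> N + K" and lo: "N \<le> \<nu> (r / p ^ 2) + K"
    and \<rho>: "1 / p \<le> \<rho>" "\<rho> \<le> p" and u: "norm u = r * \<rho>"
  shows "norm (f u) \<le> p ^ (2 * K) * (2 * p / (p - 1)) * \<mu> r * \<rho> ^ N"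
proof -
  let ?d = "\<lambda>n. (n - N) + (N - n)"
  let ?C = "p ^ (2 * K) * \<mu> r * \<rho> ^ N"
  have \<rho>_pos: "\<rho> > 0" using \<rho>(1) p by (smt (verit) divide_pos_pos)
  have C_pos: "?C \<ge> 0" using p max_term_pos[OF r] \<rho>_pos by simp
  have le: "norm (fps_nth (fps_expansion f 0) n * u ^ n) \<le> ?C * (1 / p) ^ ?d n" for n
  proof -
    have "\<rho> ^ n \<le> \<rho> ^ N * p ^ ?d n"
    proof (cases "N \<le> n")
      case True
      then obtain d where d: "n = N + d" using le_Suc_ex by blast
      then show ?thesis
        using \<rho> \<rho>_pos by (simp add: power_add power_mono)
    next
      case False
      then obtain d where d: "N = n + d" using le_Suc_ex[of n N] by auto
      have "1 \<le> (\<rho> * p) ^ d"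
        using \<rho>(1) p by (intro one_le_power) (simp add: field_simps)
      then show ?thesis
        using \<rho>_pos by (simp add: d power_add power_mult_distrib mult.assoc)
    qed
    then have "a n * (r * \<rho>) ^ n \<le> a n * r ^ n * (\<rho> ^ N * p ^ ?d n)"
      using r unfolding power_mult_distrib mult.assoc[symmetric, of "a n"]
      by (intro mult_left_mono) auto
    also have "\<dots> = (a n * r ^ n * (p ^ 2) ^ ?d n) * \<rho> ^ N * (1 / p) ^ ?d n"
      using p by (simp add: power_divide power2_eq_square power_mult_distrib)
    also have "\<dots> \<le> (\<mu> r * (p ^ 2) ^ K) * \<rho> ^ N * (1 / p) ^ ?d n"
      using term_decay[OF r _ hi lo, of n] p \<rho>_pos
      by (intro mult_right_mono) (auto simp: one_less_power)
    finally show ?thesis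
      unfolding power_mult[of p 2 K] by (simp add: norm_mult norm_power u mult_ac)
  qed
  have geo: "summable (\<lambda>n. (1 / p) ^ ?d n)" "(\<Sum>n. (1 / p) ^ ?d n) \<le> 2 / (1 - 1 / p)"
    using p by (auto intro!: two_sided_geometric)
  have "norm (f u) \<le> (\<Sum>n. ?C * (1 / p) ^ ?d n)"
    using norm_suminf_le[OF le summable_mult[OF geo(1)]] expansion_sums[of u]
    by (simp add: sums_iff)
  also have "\<dots> = ?C * (\<Sum>n. (1 / p) ^ ?d n)"
    using geo(1) by (rule suminf_mult)
  also have "\<dots> \<le> ?C * (2 / (1 - 1 / p))"
    using geo(2) C_pos by (rule mult_left_mono)
  also have "2 / (1 - 1 / p) = 2 * p / (p - 1)"
    using p by (simp add: field_simps)
  finally show ?thesis by (simp add: mult_ac)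
qed

text \<open>
  The factor \<open>B\<close> of the crude bound is absent on the circle of radius \<open>r\<close> by the definition of \<open>M\<close>. On
  the circles of radius \<open>r p\<close> and \<open>r / p\<close> it is absorbed by changing the exponent \<open>N\<close> to \<open>N + L\<close> and
  \<open>N - L\<close>, and the maximum principle carries these two bounds into the annuli.
\<close>

lemma norm_le_max_modulus_interpolated:
  assumes r: "r > 0" and p: "p > 1" and B: "B \<le> p ^ L" "L \<le> N"
    and crude: "\<And>u \<rho>. norm u = r * \<rho> \<Longrightarrow> 1 / p \<le> \<rho> \<Longrightarrow> \<rho> \<le> p \<Longrightarrow> norm (f u) \<le> B * M r * \<rho> ^ N"
    and \<rho>: "1 / p \<le> \<rho>" "\<rho> \<le> p" and u: "norm u = r * \<rho>"
  shows "norm (f u) \<le> M r * \<rho> ^ N * max \<rho> (1 / \<rho>) ^ L"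
proof -
  have M: "M r > 0" using max_term_pos[OF r] max_term_le_max_modulus[OF r] by linarith
  have \<rho>_pos: "\<rho> > 0" using \<rho>(1) p by (smt (verit) divide_pos_pos)
  have p_inv: "1 / p \<le> p" using p divide_less_eq_1_pos[of p 1] by linarith
  show ?thesis
  proof (cases "\<rho> \<ge> 1")
    case True
    have "norm (f u) \<le> M r / r ^ (N + L) * norm u ^ (N + L)"
    proof (rule holomorphic_annulus_bound[OF holomorphic r, of _ _ "r * p"])
      fix w :: complex assume w: "norm w = r * p"
      have "norm (f w) \<le> B * M r * p ^ N"
        by (rule crude[OF w p_inv order_refl])
      also have "\<dots> \<le> p ^ L * M r * p ^ N"
        using B M p by (intro mult_right_mono) auto
      finally show "norm (f w) \<le> M r / r ^ (N + L) * (r * p) ^ (N + L)"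
        using r by (simp add: power_mult_distrib power_add field_simps)
    qed (use r u \<rho> True norm_le_max_modulus in \<open>auto simp: less_imp_le\<close>)
    also have "\<dots> = M r * \<rho> ^ (N + L)"
      using u r by (simp add: power_mult_distrib)
    also have "1 / \<rho> \<le> \<rho>"
      using True \<rho>_pos divide_le_eq_1_pos[of \<rho> 1] by linarith
    then have "max \<rho> (1 / \<rho>) = \<rho>" by (rule max_absorb1)
    then have "M r * \<rho> ^ (N + L) = M r * \<rho> ^ N * max \<rho> (1 / \<rho>) ^ L"
      by (simp add: power_add)
    finally show ?thesis .
  next
    case False
    obtain m where m: "N = m + L" using B(2) le_Suc_ex[of L N] by (auto simp: add.commute)
    have "norm (f u) \<le> M r / r ^ m * norm u ^ m"
    proof (rule holomorphic_annulus_bound[OF holomorphic, of "r * (1 / p)" _ _ r])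
      fix w :: complex assume w: "norm w = r * (1 / p)"
      have "norm (f w) \<le> B * M r * (1 / p) ^ N"
        by (rule crude[OF w order_refl p_inv])
      also have "\<dots> \<le> p ^ L * M r * (1 / p) ^ N"
        using B M p by (intro mult_right_mono) auto
      finally show "norm (f w) \<le> M r / r ^ m * (r * (1 / p)) ^ m"
        using r p by (simp add: m power_divide power_add field_simps)
    next
      show "r * (1 / p) \<le> norm u"
        unfolding u using r \<rho> by (intro mult_left_mono) auto
    qed (use r p u \<rho> False norm_le_max_modulus in auto)
    also have "\<dots> = M r * \<rho> ^ m"
      using u r by (simp add: power_mult_distrib)
    also have "max \<rho> (1 / \<rho>) = 1 / \<rho>"
      using False \<rho>_pos power_mono[of \<rho> 1 2] by (simp add: max_def field_simps power2_eq_square) 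
    then have "M r * \<rho> ^ m = M r * \<rho> ^ N * max \<rho> (1 / \<rho>) ^ L"
      using \<rho>_pos by (simp add: m power_add power_divide)
    finally show ?thesis .
  qed
qed

text \<open>
  With \<open>N = \<nu>(r)\<close> one has \<open>e^N \<mu>(r) \<le> \<mu>(e r) \<le> M(e r)\<close>, so that \<open>N \<le> log M(e r) \<le> (e r)^s\<close> for large
  \<open>r\<close>. Then \<open>N^(2 - s)\<close> is at most a constant times \<open>r^(s (2 - s))\<close>, and \<open>s (2 - s) \<le> 1\<close>, which is the
  claim.
\<close>

lemma central_index_growth:
  assumes order: "growth_order f < ereal s" and s: "s < 1"
  shows "\<exists>C. eventually (\<lambda>r. real (\<nu> r) / r \<le> C * real (\<nu> r) powr (s - 1)) at_top"
proof -
  have "eventually (\<lambda>r. ereal (ln (ln (M r)) / ln r) < ereal s) at_top"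
    using order unfolding growth_order_def by (rule Limsup_lessD)
  then have ev1: "eventually (\<lambda>r. ln (ln (M (exp 1 * r))) / ln (exp 1 * r) < s) at_top"
    by (auto intro!: eventually_compose_filterlim[where f = "\<lambda>r. exp 1 * r"]
        filterlim_tendsto_pos_mult_at_top[OF tendsto_const] filterlim_ident)
  obtain m where m: "m > 0" "a m > 0" using infinitely_many_coeffs by blast
  have "filterlim (\<lambda>r. a m * r ^ m) at_top at_top"
    using m by (intro filterlim_tendsto_pos_mult_at_top[OF tendsto_const]
        filterlim_pow_at_top filterlim_ident) auto
  then have ev2: "eventually (\<lambda>r. 1 \<le> a m * r ^ m) at_top"
    by (simp add: filterlim_at_top)
  have ev3: "eventually (\<lambda>r. 1 \<le> \<nu> r) at_top"
    using central_index_at_top by (simp add: filterlim_at_top)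
  have "eventually (\<lambda>r. real (\<nu> r) / r \<le> exp (s * (2 - s)) * real (\<nu> r) powr (s - 1)) at_top"
    using ev1 ev2 ev3 eventually_gt_at_top[of 1]
  proof eventually_elim
    case (elim r)
    let ?N = "real (\<nu> r)"
    have r: "r > 1" by fact
    have N: "?N \<ge> 1" using elim by simp
    have "1 \<le> \<mu> r" using elim(2) term_le_max_term[of r m] r by linarith
    then have "exp ?N \<le> \<mu> r * exp ?N" by simp
    also have "\<dots> = a (\<nu> r) * (exp 1 * r) ^ \<nu> r"
      using central_index_maximal(1)[of r] r by (simp add: power_mult_distrib mult_ac flip: exp_of_nat_mult)
    also have "\<dots> \<le> M (exp 1 * r)"
      using term_le_max_term[of "exp 1 * r" "\<nu> r"] max_term_le_max_modulus[of "exp 1 * r"] r by simp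
    finally have N_le: "?N \<le> ln (M (exp 1 * r))"
      by (metis exp_gt_zero ln_exp ln_le_cancel_iff less_le_trans)
    have er: "exp 1 * r > 1" using r by (smt (verit) exp_ge_add_one_self mult_less_cancel_left2 mult_le_cancel_right1)
    have "ln (ln (M (exp 1 * r))) < s * ln (exp 1 * r)"
      using elim(1) er by (simp add: field_simps)
    then have "ln (M (exp 1 * r)) < exp (s * ln (exp 1 * r))"
      using N N_le by (metis exp_less_cancel_iff exp_ln less_le_trans zero_less_one)
    then have N_le': "?N \<le> (exp 1 * r) powr s"
      using N_le er r by (simp add: powr_def)
    have "?N powr (2 - s) \<le> ((exp 1 * r) powr s) powr (2 - s)"
      using N_le' s by (intro powr_mono2) auto
    also have "\<dots> = exp (s * (2 - s)) * r powr (s * (2 - s))"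
      using r by (simp add: powr_powr powr_mult exp_powr_real)
    also have "\<dots> \<le> exp (s * (2 - s)) * r powr 1"
    proof (intro mult_left_mono powr_mono)
      have "0 \<le> (1 - s) ^ 2" by simp
      then show "s * (2 - s) \<le> 1" by (simp add: power2_eq_square algebra_simps)
    qed (use r in auto)
    finally have "?N powr (2 - s) \<le> exp (s * (2 - s)) * r" using r by simp
    moreover have "?N powr (2 - s) * ?N powr (s - 1) = ?N"
      using N by (simp flip: powr_add)
    ultimately have "?N \<le> exp (s * (2 - s)) * r * ?N powr (s - 1)"
      by (metis mult_right_mono powr_ge_zero)
    then show ?case using r by (simp add: field_simps)
  qed
  then show ?thesis by blast
qed

text \<open>
  Puts the quantitative pieces together for \<open>p = gap_ratio i\<close>. Since \<open>N\<close> lies between \<open>i^3\<close> and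
  \<open>(i + 1)^3\<close>, the number \<open>L\<close> is at least \<open>i^(9/4)\<close>, and \<open>p^L \<ge> exp(L / (2 (i + 1)^2))\<close> exceeds the factor
  \<open>B = O(i^2)\<close> of the crude bound once \<open>i\<close> is large. The exponent \<open>3/4\<close> exceeds \<open>2/3\<close>,
  as this argument requires, and keeps \<open>L / N\<close> at \<open>O(N^(- 1/4))\<close>.
\<close>

lemma max_modulus_growth_between_jumps:
  "\<exists>n0. \<forall>r i. r > 0 \<longrightarrow> n0 \<le> \<nu> r \<longrightarrow>
     i ^ 3 \<le> \<nu> (r / gap_ratio i ^ 2) \<and> \<nu> (r * gap_ratio i ^ 2) < (i + 1) ^ 3 \<longrightarrow>
     (let L = nat \<lceil>real (\<nu> r) powr (3 / 4)\<rceil>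
      in 8 * L \<le> \<nu> r \<and>
        (\<forall>u \<rho>. norm u = r * \<rho> \<longrightarrow> \<bar>\<rho> - 1\<bar> \<le> 1 / (4 * real L) \<longrightarrow>
          norm (f u) \<le> M r * \<rho> ^ \<nu> r * max \<rho> (1 / \<rho>) ^ L))"
proof -
  have "eventually (\<lambda>n. 8 * (real n powr (3 / 4) + 1) \<le> real n) sequentially"
    by real_asymp
  then obtain n1 where n1: "\<And>n. n \<ge> n1 \<Longrightarrow> 8 * (real n powr (3 / 4) + 1) \<le> real n"
    by (auto simp: eventually_sequentially)
  have "eventually (\<lambda>i. 2 * exp 6 * (real (i + 1) ^ 2 + 1)
      \<le> exp (real i powr (9 / 4) / (2 * real (i + 1) ^ 2)) \<and>
      real (i + 1) ^ 2 \<le> real i powr (9 / 4)) sequentially"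
    by (intro eventually_conj; real_asymp)
  then obtain i1 where i1: "\<And>i. i \<ge> i1 \<Longrightarrow> 2 * exp 6 * (real (i + 1) ^ 2 + 1)
      \<le> exp (real i powr (9 / 4) / (2 * real (i + 1) ^ 2))"
      "\<And>i. i \<ge> i1 \<Longrightarrow> real (i + 1) ^ 2 \<le> real i powr (9 / 4)"
    by (auto simp: eventually_sequentially)
  define n0 where "n0 = max n1 (i1 ^ 3) + 1"
  show ?thesis
  proof (intro exI[of _ n0] allI impI)
    fix r :: real and i :: nat
    assume r: "r > 0" and n0: "n0 \<le> \<nu> r"
    define p where "p = 1 + 1 / real (i + 1) ^ 2"
    define N where "N = \<nu> r"
    define K where "K = (i + 1) ^ 3 - i ^ 3"
    define L where "L = nat \<lceil>real N powr (3 / 4)\<rceil>"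
    assume "i ^ 3 \<le> \<nu> (r / gap_ratio i ^ 2) \<and> \<nu> (r * gap_ratio i ^ 2) < (i + 1) ^ 3"
    then have lo: "i ^ 3 \<le> \<nu> (r / p ^ 2)" and hi: "\<nu> (r * p ^ 2) < (i + 1) ^ 3"
      by (simp_all add: p_def gap_ratio_def)
    have p: "p > 1" by (simp add: p_def)
    have p2: "p ^ 2 > 1" using p by (simp add: one_less_power)
    have N_lo: "i ^ 3 \<le> N"
    proof -
      have "r / p ^ 2 \<le> r" using divide_left_mono[of 1 "p ^ 2" r] r p p2 by simp
      then have "\<nu> (r / p ^ 2) \<le> N"
        unfolding N_def using r p by (intro central_index_mono) auto
      with lo show ?thesis by simp
    qed
    have N_hi: "N < (i + 1) ^ 3"
    proof -
      have "r \<le> r * p ^ 2" using r p2 by simp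
      then have "N \<le> \<nu> (r * p ^ 2)"
        unfolding N_def using r by (intro central_index_mono) auto
      with hi show ?thesis by simp
    qed
    have N1: "n1 \<le> N" "N \<ge> 1" using n0 by (auto simp: n0_def N_def)
    have i: "i1 \<le> i"
    proof (rule ccontr)
      assume "\<not> ?thesis"
      then have "(i + 1) ^ 3 \<le> i1 ^ 3" by (intro power_mono) auto
      then show False using n0 N_hi unfolding n0_def N_def by linarith
    qed
    have L_lo: "real N powr (3 / 4) \<le> real L"
      unfolding L_def by (rule real_nat_ceiling_ge)
    have L_hi: "real L \<le> real N powr (3 / 4) + 1"
      unfolding L_def by (simp add: of_nat_ceiling)
    have L8: "8 * L \<le> N"
    proof -
      have "real (8 * L) \<le> real N" using n1[OF N1(1)] L_hi by simp
      then show ?thesis by linarith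
    qed
    have L_i: "real i powr (9 / 4) \<le> real L"
    proof -
      have "real i powr (9 / 4) = real (i ^ 3) powr (3 / 4)"
        by (simp add: powr_powr flip: powr_numeral)
      also have "\<dots> \<le> real N powr (3 / 4)"
        using N_lo by (intro powr_mono2) (auto simp flip: of_nat_power)
      finally show ?thesis using L_lo by linarith
    qed
    have K: "real K \<le> 3 * real (i + 1) ^ 2"
    proof -
      have "i ^ 3 \<le> (i + 1) ^ 3" by (intro power_mono) auto
      then have "real K = real (i + 1) ^ 3 - real i ^ 3"
        unfolding K_def by (simp add: of_nat_diff)
      then show ?thesis
        by (simp add: power3_eq_cube power2_eq_square algebra_simps)
    qed
    have B: "p ^ (2 * K) * (2 * p / (p - 1)) \<le> p ^ L"
    proof -
      have x: "0 < 1 / real (i + 1) ^ 2" "1 / real (i + 1) ^ 2 \<le> 1" by simp_all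
      have "p ^ (2 * K) \<le> exp (1 / real (i + 1) ^ 2) ^ (2 * K)"
        unfolding p_def by (intro power_mono exp_ge_add_one_self) auto
      also have "\<dots> = exp (2 * (real K / real (i + 1) ^ 2))"
        by (simp flip: exp_of_nat_mult)
      also have "\<dots> \<le> exp 6"
        using K by (simp add: field_simps)
      finally have 1: "p ^ (2 * K) \<le> exp 6" .
      have 2: "2 * p / (p - 1) = 2 * (real (i + 1) ^ 2 + 1)"
        by (simp add: p_def field_simps)
      have "p ^ (2 * K) * (2 * p / (p - 1)) \<le> exp 6 * (2 * (real (i + 1) ^ 2 + 1))"
        unfolding 2 using 1 by (intro mult_right_mono) auto
      also have "\<dots> \<le> exp (real i powr (9 / 4) / (2 * real (i + 1) ^ 2))"
        using i1(1)[OF i] by (simp only: mult_ac)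
      also have "\<dots> \<le> exp (real L / (2 * real (i + 1) ^ 2))"
        using L_i by (intro exp_mono divide_right_mono) auto
      also have "\<dots> = exp (1 / real (i + 1) ^ 2 / 2) ^ L"
        by (simp flip: exp_of_nat_mult)
      also have "\<dots> \<le> p ^ L"
      proof (intro power_mono)
        have "exp (y / 2) \<le> 1 + y" if "0 \<le> y" "y \<le> 1" for y :: real
        proof -
          have "exp (y / 2) \<le> 1 + y / 2 + (y / 2) ^ 2"
            using that by (intro exp_bound) auto
          moreover have "(y / 2) ^ 2 \<le> y / 2"
            using that power_decreasing[of 1 2 "y / 2"] by simp
          ultimately show ?thesis by simp
        qed
        then show "exp (1 / real (i + 1) ^ 2 / 2) \<le> p"
          using x unfolding p_def by (meson less_imp_le)
      qed simp
      finally show ?thesis .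
    qed
    have crude: "norm (f u) \<le> p ^ (2 * K) * (2 * p / (p - 1)) * M r * \<rho> ^ N"
      if "norm u = r * \<rho>" "1 / p \<le> \<rho>" "\<rho> \<le> p" for u \<rho>
    proof -
      have "\<nu> (r * p ^ 2) \<le> N + K" "N \<le> \<nu> (r / p ^ 2) + K"
        using lo hi N_lo N_hi by (auto simp: K_def)
      then have "norm (f u) \<le> p ^ (2 * K) * (2 * p / (p - 1)) * \<mu> r * \<rho> ^ N"
        using that r p by (intro norm_le_max_term) auto
      also have "\<dots> \<le> p ^ (2 * K) * (2 * p / (p - 1)) * M r * \<rho> ^ N"
      proof (intro mult_left_mono mult_right_mono max_term_le_max_modulus r)
        have "0 \<le> \<rho>" using that p by (smt (verit) divide_pos_pos)
        then show "0 \<le> \<rho> ^ N" by simp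
      qed (use p in auto)
      finally show ?thesis .
    qed
    have "norm (f u) \<le> M r * \<rho> ^ N * max \<rho> (1 / \<rho>) ^ L"
      if u: "norm u = r * \<rho>" and \<rho>: "\<bar>\<rho> - 1\<bar> \<le> 1 / (4 * real L)" for u \<rho>
    proof (rule norm_le_max_modulus_interpolated[OF r p B _ crude])
      have iL: "real (i + 1) ^ 2 \<le> real L" using i1(2)[OF i] L_i by linarith
      have i_pos: "0 < real (i + 1) ^ 2" by simp
      define x where "x = 1 / real (i + 1) ^ 2"
      have x: "0 < x" "x \<le> 1" by (simp_all add: x_def)
      have "1 / (4 * real L) \<le> 1 / (4 * real (i + 1) ^ 2)"
        using iL less_le_trans[OF i_pos iL] i_pos by (intro divide_left_mono mult_pos_pos mult_left_mono) auto
      then have \<rho>x: "\<bar>\<rho> - 1\<bar> \<le> x / 4" using \<rho> by (simp add: x_def)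
      have p_x: "p = 1 + x" by (simp add: p_def x_def)
      show "\<rho> \<le> p" unfolding p_x using \<rho>x x by linarith
      have "1 \<le> (1 + x) * (1 - x / 4)"
        using mult_left_mono[OF x(2), of x] x by (simp add: algebra_simps)
      also have "\<dots> \<le> (1 + x) * \<rho>"
      proof (rule mult_left_mono)
        show "1 - x / 4 \<le> \<rho>" using \<rho>x by linarith
      qed (use x in simp)
      finally show "1 / p \<le> \<rho>"
        unfolding p_x using x by (simp add: field_simps)
    qed (use L8 u in auto)
    with L8 show "let L = nat \<lceil>real (\<nu> r) powr (3 / 4)\<rceil>
      in 8 * L \<le> \<nu> r \<and>
        (\<forall>u \<rho>. norm u = r * \<rho> \<longrightarrow> \<bar>\<rho> - 1\<bar> \<le> 1 / (4 * real L) \<longrightarrow>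
          norm (f u) \<le> M r * \<rho> ^ \<nu> r * max \<rho> (1 / \<rho>) ^ L)"
      unfolding Let_def L_def N_def by auto
  qed
qed

section \<open>Asymptotics of the iterated difference\<close>

text \<open>
  The two error terms are the distance of \<open>f(z + w)\<close> from \<open>f(z) exp(N w / z)\<close>, of relative size \<open>L / N\<close>
  with respect to \<open>M\<close>, and the variation of \<open>exp(N w / z)\<close> for \<open>\<bar>w\<bar> \<le> k\<close>, of relative size \<open>N / r\<close>. All
  conditions that need a large radius are met by putting the bounded radii into \<open>E\<close>.
\<close>

lemma forward_diff_asymptotics:
  assumes order: "growth_order f < ereal s" and s: "s < 1"
  obtains E C where "E \<subseteq> {1<..}" "finite_log_measure E"
    "\<And>z. norm z > 1 \<Longrightarrow> norm z \<notin> E \<Longrightarrow> \<nu> (norm z) \<ge> 1 \<and>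
      norm ((forward_diff ^^ k) f z - f z * (of_nat (\<nu> (norm z)) / z) ^ k)
        \<le> C * (real (\<nu> (norm z)) / norm z) ^ k *
          (M (norm z) * real (\<nu> (norm z)) powr (- 1 / 4) + norm (f z) * real (\<nu> (norm z)) powr (s - 1))"
proof -
  obtain n0 where n0: "\<And>r i. r > 0 \<Longrightarrow> n0 \<le> \<nu> r \<Longrightarrow>
     i ^ 3 \<le> \<nu> (r / gap_ratio i ^ 2) \<and> \<nu> (r * gap_ratio i ^ 2) < (i + 1) ^ 3 \<Longrightarrow>
     (let L = nat \<lceil>real (\<nu> r) powr (3 / 4)\<rceil>
      in 8 * L \<le> \<nu> r \<and>
        (\<forall>u \<rho>. norm u = r * \<rho> \<longrightarrow> \<bar>\<rho> - 1\<bar> \<le> 1 / (4 * real L) \<longrightarrow>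
          norm (f u) \<le> M r * \<rho> ^ \<nu> r * max \<rho> (1 / \<rho>) ^ L))"
    using max_modulus_growth_between_jumps by metis
  obtain C where C: "eventually (\<lambda>r. real (\<nu> r) / r \<le> C * real (\<nu> r) powr (s - 1)) at_top"
    using central_index_growth[OF order s] by blast
  have "filterlim (\<lambda>r. real (\<nu> r)) at_top at_top"
    using filterlim_compose[OF filterlim_real_sequentially central_index_at_top] .
  then have "((\<lambda>r. real (\<nu> r) powr (s - 1)) \<longlongrightarrow> 0) at_top"
    using s by (intro tendsto_neg_powr) auto
  then have "((\<lambda>r. 2 * real k * (C * real (\<nu> r) powr (s - 1))) \<longlongrightarrow> 2 * real k * (C * 0)) at_top"
    by (intro tendsto_intros)
  then have "eventually (\<lambda>r. 2 * real k * (C * real (\<nu> r) powr (s - 1)) < 1) at_top"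
    by (rule order_tendstoD) simp
  moreover have "eventually (\<lambda>r. max n0 1 \<le> \<nu> r) at_top"
    using central_index_at_top by (simp only: filterlim_at_top)
  ultimately have "eventually (\<lambda>r. max n0 1 \<le> \<nu> r \<and> 2 * real k * real (\<nu> r) \<le> r \<and>
      real (\<nu> r) / r \<le> C * real (\<nu> r) powr (s - 1)) at_top"
    using C eventually_gt_at_top[of 0]
  proof eventually_elim
    case (elim r)
    have "2 * real k * (real (\<nu> r) / r) \<le> 2 * real k * (C * real (\<nu> r) powr (s - 1))"
      using elim by (intro mult_left_mono) auto
    then have "2 * real k * (real (\<nu> r) / r) \<le> 1" using elim by linarith
    then show ?case using elim by (simp add: field_simps)
  qed
  then obtain r0 where r0: "\<forall>r>r0. max n0 1 \<le> \<nu> r \<and> 2 * real k * real (\<nu> r) \<le> r \<and>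
      real (\<nu> r) / r \<le> C * real (\<nu> r) powr (s - 1)"
    unfolding eventually_at_top_dense by (elim exE) 
  have unbounded: "\<exists>r>0. n \<le> \<nu> r" for n
  proof -
    have "eventually (\<lambda>r. n \<le> \<nu> r \<and> (0::real) < r) at_top"
      using central_index_at_top by (intro eventually_conj eventually_gt_at_top) (simp only: filterlim_at_top)
    from eventually_happens'[OF trivial_limit_at_top_linorder this] show ?thesis by blast
  qed
  obtain E where E: "E \<subseteq> {1<..}" "finite_log_measure E" "{1<..r0} \<subseteq> E"
    and gap: "\<And>r. r > 1 \<Longrightarrow> r \<notin> E \<Longrightarrow> \<nu> r \<ge> 1 \<Longrightarrow>
      \<exists>i. i ^ 3 \<le> \<nu> (r / gap_ratio i ^ 2) \<and> \<nu> (r * gap_ratio i ^ 2) < (i + 1) ^ 3"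
    by (rule monotone_slow_growth[OF central_index_mono unbounded, where ?r0.0 = r0],
        assumption, assumption, rule that)
  define C1 :: real where "C1 = fact k * 2 ^ k * (8 * exp 2) * 2"
  define C2 where "C2 = 3 / 2 * real k * C"
  show ?thesis
  proof (rule that[OF E(1,2)])
    fix z :: complex assume z1: "norm z > 1" and zE: "norm z \<notin> E"
    define r where "r = norm z"
    define N where "N = \<nu> r"
    define L where "L = nat \<lceil>real N powr (3 / 4)\<rceil>"
    have r: "r > 1" using z1 by (simp add: r_def)
    have "r > r0" using E(3) zE r by (auto simp: r_def not_le)
    then have N: "n0 \<le> N" "1 \<le> N" "2 * real k * real N \<le> r"
      and N_r: "real N / r \<le> C * real N powr (s - 1)"
      using r0 by (simp_all add: N_def)
    have M_pos: "M r > 0"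
      using max_term_pos[of r] max_term_le_max_modulus[of r] r by simp
    obtain i where i: "i ^ 3 \<le> \<nu> (r / gap_ratio i ^ 2) \<and> \<nu> (r * gap_ratio i ^ 2) < (i + 1) ^ 3"
      using gap[OF r] zE N(2) by (auto simp: r_def N_def)
    have L8: "8 * L \<le> N" and growth: "\<And>u \<rho>. norm u = r * \<rho> \<Longrightarrow> \<bar>\<rho> - 1\<bar> \<le> 1 / (4 * real L) \<Longrightarrow>
          norm (f u) \<le> M r * \<rho> ^ N * max \<rho> (1 / \<rho>) ^ L"
      using n0[OF _ _ i] r N(1) unfolding Let_def L_def N_def by auto
    have N_powr: "real N powr (3 / 4) \<ge> 1" using N(2) by (intro ge_one_powr_ge_zero) auto
    have L_lo: "real N powr (3 / 4) \<le> real L"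
      unfolding L_def by (rule real_nat_ceiling_ge)
    have L_hi: "real L \<le> 2 * real N powr (3 / 4)"
      using N_powr unfolding L_def by (simp add: of_nat_ceiling) linarith
    have "L \<ge> 1" using L_lo N_powr by linarith
    have NL: "N \<le> L ^ 2"
    proof -
      have "real N = real N powr 1" using N(2) by simp
      also have "\<dots> \<le> real N powr (3 / 4 * 2)" using N(2) by (intro powr_mono) auto
      also have "\<dots> = (real N powr (3 / 4)) ^ 2"
        using N(2) by (simp add: powr_powr flip: powr_numeral)
      also have "\<dots> \<le> real L ^ 2" using L_lo by (intro power_mono) auto
      finally show ?thesis by (simp flip: of_nat_power)
    qed
    have LN: "real L / real N \<le> 2 * real N powr (- 1 / 4)"
    proof -
      have "real N powr (3 / 4) = real N powr (- 1 / 4) * real N"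
        using N(2) powr_add[of "real N" "- 1 / 4" 1] by simp
      then show ?thesis using L_hi N(2) by (simp add: field_simps)
    qed
    have "norm ((forward_diff ^^ k) f z - f z * (of_nat N / z) ^ k)
      \<le> (real N / r) ^ k * (fact k * 2 ^ k * (8 * exp 2) * (real L / real N) * M r
        + 3 / 2 * real k * (real N / r) * norm (f z))"
      using r_def r M_pos \<open>L \<ge> 1\<close> NL L8 N(3) growth
      by (intro forward_diff_local_comparison[OF holomorphic]) auto
    also have "\<dots> \<le> (real N / r) ^ k * (C1 * (M r * real N powr (- 1 / 4)) + C2 * (norm (f z) * real N powr (s - 1)))"
    proof (intro mult_left_mono add_mono)
      show "fact k * 2 ^ k * (8 * exp 2) * (real L / real N) * M r \<le> C1 * (M r * real N powr (- 1 / 4))"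
        using mult_left_mono[OF LN, of "fact k * 2 ^ k * (8 * exp 2) * M r"] M_pos
        by (simp add: C1_def mult_ac)
      show "3 / 2 * real k * (real N / r) * norm (f z) \<le> C2 * (norm (f z) * real N powr (s - 1))"
        using mult_left_mono[OF N_r, of "3 / 2 * real k * norm (f z)"] by (simp add: C2_def mult_ac)
    qed (use r in auto)
    also have "\<dots> \<le> (real N / r) ^ k * (max C1 C2 * (M r * real N powr (- 1 / 4)) + max C1 C2 * (norm (f z) * real N powr (s - 1)))"
      using M_pos r by (intro mult_left_mono add_mono mult_right_mono) auto
    also have "\<dots> = max C1 C2 * (real N / r) ^ k * (M r * real N powr (- 1 / 4) + norm (f z) * real N powr (s - 1))"
      by (simp add: algebra_simps)
    finally show "\<nu> (norm z) \<ge> 1 \<and>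
      norm ((forward_diff ^^ k) f z - f z * (of_nat (\<nu> (norm z)) / z) ^ k)
        \<le> max C1 C2 * (real (\<nu> (norm z)) / norm z) ^ k *
          (M (norm z) * real (\<nu> (norm z)) powr (- 1 / 4) + norm (f z) * real (\<nu> (norm z)) powr (s - 1))"
      using N(2) by (simp add: N_def r_def)
  qed
qed

end

text \<open>
  The lower bound for \<open>\<bar>f(z)\<bar>\<close> turns \<open>M(r) N^(- 1/4)\<close> into \<open>\<bar>f(z)\<bar> N^(- 1/8 - \<epsilon>)\<close>, and \<open>s = \<sigma> + \<epsilon>\<close> makes
  the other error \<open>\<bar>f(z)\<bar> N^(- (1 - \<sigma>) + \<epsilon>)\<close>. Both exponents are at most \<open>- \<kappa> + \<epsilon>\<close>. The function \<open>R\<close> is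
  defined by solving the asserted identity for it.
\<close>

theorem theorem5p2:
  fixes f :: "complex \<Rightarrow> complex" and \<sigma> \<epsilon> :: real and k :: nat
  assumes "transcendental_entire f"
    and "growth_order f = ereal \<sigma>"
    and "\<sigma> < 1"
    and "0 < \<epsilon>"
    and "\<epsilon> < min (1/8) (1 - \<sigma>)"
    and "k \<ge> 1"
  shows "\<exists>(E :: real set) (R :: complex \<Rightarrow> complex).
    E \<subseteq> {1<..} \<and> finite_log_measure E \<and>
    (let \<kappa> = min (1/8) (1 - \<sigma>);
         S = {z. \<exists>r. r \<notin> E \<union> {0..1} \<and> norm z = r \<and>
                norm (f z) > max_modulus r f * real (central_index r f) powr (- (1/8) + \<epsilon>)}
     in (\<forall>z\<in>S. (forward_diff ^^ k) f z / f z =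
                 (of_nat (central_index (norm z) f) / z) ^ k * (1 + R z)) \<and>
        R \<in> O[inf at_infinity (principal S)](
              \<lambda>z. of_real (real (central_index (norm z) f) powr (- \<kappa> + \<epsilon>))))"
proof -
  interpret transcendental_function f
    by unfold_locales (rule assms(1))
  obtain E C where E: "E \<subseteq> {1<..}" "finite_log_measure E"
    and main: "\<And>z. norm z > 1 \<Longrightarrow> norm z \<notin> E \<Longrightarrow> \<nu> (norm z) \<ge> 1 \<and>
      norm ((forward_diff ^^ k) f z - f z * (of_nat (\<nu> (norm z)) / z) ^ k)
        \<le> C * (real (\<nu> (norm z)) / norm z) ^ k *
          (M (norm z) * real (\<nu> (norm z)) powr (- 1 / 4) + norm (f z) * real (\<nu> (norm z)) powr (\<sigma> + \<epsilon> - 1))"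
  proof (rule forward_diff_asymptotics[of "\<sigma> + \<epsilon>" k])
    show "growth_order f < ereal (\<sigma> + \<epsilon>)" "\<sigma> + \<epsilon> < 1"
      using assms(2,4,5) by simp_all
  qed (rule that)
  define \<kappa> where "\<kappa> = min (1/8) (1 - \<sigma>)"
  define S where "S = {z. \<exists>r. r \<notin> E \<union> {0..1} \<and> norm z = r \<and>
      norm (f z) > M r * real (\<nu> r) powr (- (1/8) + \<epsilon>)}"
  define R where "R z = (forward_diff ^^ k) f z / f z / (of_nat (\<nu> (norm z)) / z) ^ k - 1" for z
  have S: "norm z > 1" "\<nu> (norm z) \<ge> 1" "norm (R z) \<le> 2 * \<bar>C\<bar> * real (\<nu> (norm z)) powr (- \<kappa> + \<epsilon>)"
    if z: "z \<in> S" for z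
  proof -
    define r where "r = norm z"
    define N where "N = real (\<nu> r)"
    have r_notin: "r \<notin> E" and r: "r > 1"
      and big: "norm (f z) > M r * N powr (- (1/8) + \<epsilon>)"
      using z by (auto simp: S_def r_def N_def not_le)
    show "norm z > 1" using r by (simp add: r_def)
    have "\<nu> r \<ge> 1"
      and diff: "norm ((forward_diff ^^ k) f z - f z * (of_nat (\<nu> r) / z) ^ k)
        \<le> C * (N / r) ^ k * (M r * N powr (- 1 / 4) + norm (f z) * N powr (\<sigma> + \<epsilon> - 1))"
      using main[of z] r r_notin by (auto simp: r_def N_def)
    then show "\<nu> (norm z) \<ge> 1" by (simp add: r_def)
    have N: "N \<ge> 1" using \<open>\<nu> r \<ge> 1\<close> by (simp add: N_def)
    have "M r > 0" using max_term_pos[of r] max_term_le_max_modulus[of r] r by simp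
    then have "0 \<le> M r * N powr (- (1/8) + \<epsilon>)" by simp
    with big have f_pos: "norm (f z) > 0" by linarith
    let ?D = "f z * (of_nat (\<nu> r) / z) ^ k"
    have D: "norm ?D = norm (f z) * (N / r) ^ k"
      by (simp add: norm_mult norm_power norm_divide r_def N_def)
    have D_pos: "norm ?D > 0" using f_pos N r unfolding D by simp
    have t1: "M r * N powr (- 1 / 4) \<le> norm (f z) * N powr (- \<kappa> + \<epsilon>)"
    proof -
      have "M r * N powr (- 1 / 4) = (M r * N powr (- (1/8) + \<epsilon>)) * N powr (- (1/8) - \<epsilon>)"
        by (simp add: mult.assoc flip: powr_add)
      also have "\<dots> \<le> norm (f z) * N powr (- \<kappa> + \<epsilon>)"
      proof (intro mult_mono powr_mono)
        show "- (1/8) - \<epsilon> \<le> - \<kappa> + \<epsilon>" using assms(4) by (simp add: \<kappa>_def)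
      qed (use big N in auto)
      finally show ?thesis .
    qed
    have t2: "norm (f z) * N powr (\<sigma> + \<epsilon> - 1) \<le> norm (f z) * N powr (- \<kappa> + \<epsilon>)"
      using N by (intro mult_left_mono powr_mono) (auto simp: \<kappa>_def)
    have "R z = ((forward_diff ^^ k) f z - ?D) / ?D"
      using D_pos by (simp add: R_def r_def diff_divide_distrib)
    then have "norm (R z) = norm ((forward_diff ^^ k) f z - ?D) / norm ?D"
      by (simp only: norm_divide)
    also have "\<dots> \<le> (C * (N / r) ^ k * (M r * N powr (- 1 / 4) + norm (f z) * N powr (\<sigma> + \<epsilon> - 1))) / norm ?D"
      using diff by (rule divide_right_mono) simp
    also have "\<dots> \<le> (\<bar>C\<bar> * (N / r) ^ k * (norm (f z) * N powr (- \<kappa> + \<epsilon>) + norm (f z) * N powr (- \<kappa> + \<epsilon>))) / norm ?D"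
      using N r \<open>M r > 0\<close>
      by (intro divide_right_mono mult_mono[OF _ add_mono[OF t1 t2]] mult_right_mono) auto
    also have "\<dots> = 2 * \<bar>C\<bar> * N powr (- \<kappa> + \<epsilon>)"
      unfolding D using N r f_pos by simp
    finally show "norm (R z) \<le> 2 * \<bar>C\<bar> * real (\<nu> (norm z)) powr (- \<kappa> + \<epsilon>)"
      by (simp add: N_def r_def)
  qed
  have "\<forall>z\<in>S. (forward_diff ^^ k) f z / f z = (of_nat (\<nu> (norm z)) / z) ^ k * (1 + R z)"
  proof
    fix z assume z: "z \<in> S"
    have "(of_nat (\<nu> (norm z)) / z) ^ k \<noteq> 0" using S(1,2)[OF z] by auto
    then show "(forward_diff ^^ k) f z / f z = (of_nat (\<nu> (norm z)) / z) ^ k * (1 + R z)"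
      by (simp add: R_def)
  qed
  moreover have "R \<in> O[inf at_infinity (principal S)](\<lambda>z. of_real (real (\<nu> (norm z)) powr (- \<kappa> + \<epsilon>)))"
    by (rule bigoI[of _ "2 * \<bar>C\<bar>"]) (use S(3) in \<open>auto simp: eventually_inf_principal\<close>)
  ultimately show ?thesis
    using E unfolding \<kappa>_def S_def Let_def by blast
qed

end
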